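(* Let $\operatorname{OGr}(n,2n+1)\subset\mathbb P^{2^n-1}$ denote the orthogonal Grassmannian, embedded via the spin representation, with defining (homogeneous) ideal $\mathcal I_n\subseteq\mathbb C[x_S: S\subseteq[n]]$. There exists a generating set $\mathcal P_n$ of $\mathcal I_n$ such that: - $\mathcal P_n$ forms a basis for the degree two graded piece of $\mathcal I_n$ (as a $\mathbb C$-vector space); - the tropicalisation of $\mathcal P_n$, i.e. the set $\{\operatorname{trop}(f): f\in\mathcal P_n\}$, equals the set $\mathcal G_n$ of peerless antipode equations on $[n]$.
   Context: Orthogonal Grassmannian: equip $\mathbb C^{2n+1}$, with basis $e_1,\dots,e_n,f_1,\dots,f_n,e_0$, with the nondegenerate quadratic form $q(\sum a_ie_i+\sum b_if_i+ce_0)=\sum a_ib_i+c^2$. $\operatorname{OGr}(n,2n+1)$ is the variety of $n$-dimensional (maximal) isotropic subspaces of $\mathbb C^{2n+1}$. The spin representation is the $2^n$-dimensional space $\mathcal S=\bigwedge^\bullet W$, $W=\operatorname{span}(e_1,\dots,e_n)$, on which the Clifford algebra of $q$ acts with $e_i$ acting by left exterior multiplication, $f_i$ by contraction against $e_i$, and $e_0$ by $(-1)^{\deg}$. It has the weight basis $e_S=e_{i_1}\wedge\dots\wedge e_{i_k}$ for $S=\{i_1<\dots<i_k\}\subseteq[n]$, with dual coordinates $x_S$; the weights are in bijection with vertices of the $n$-cube. The embedding $\operatorname{OGr}(n,2n+1)\hookrightarrow\mathbb P(\mathcal S)=\mathbb P^{2^n-1}$ sends $L$ to the line $\{s\in\mathcal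 S: v\cdot s=0\ \forall v\in L\}$. $\mathcal I_n$ is the homogeneous ideal of all polynomials vanishing on the image. Tropicalisation: let $X=\{x_S:S\subseteq[n]\}$ and let $\mathbb B=\{0,1\}$ be the Boolean semifield ($1\oplus1=1$). $\mathbb B[X]$ is the set of formal sums $\bigoplus_{a\in A}X^{\odot a}$ with $A\subset\mathbb N^X$ finite (so an element is determined by its set $A$ of monomials). $\operatorname{trop}:\mathbb C[X]\to\mathbb B[X]$ sends $\sum_{a\in A}z_aX^a$, with all $z_a\ne0$, to $\bigoplus_{a\in A}X^{\odot a}$. Peerless antipode equations: for $I,J\subseteq[n]$, the antipodes of the cube $\square_{I,J}=\operatorname{conv}\{\varepsilon_S: I\cap J\subseteq S\subseteq I\cup J\}$ ($\varepsilon_S\in\mathbb R^n$ the indicator vector of $S$) are the pairs $(\varepsilon_S,\varepsilon_T)$ with $S\cap T=I\cap J$ and $S\triangle T=I\triangle J$. Set $g_{I,J}=\bigoplus x_S\odot x_T$, the sum over all antipodes $(\varepsilon_S,\varepsilon_T)$ of $\square_{I,J}$. Then $\mathcal G_n=\{g_{I,J}: I,J\subseteq[n],\ |I\triangle J|\ge3\}$, regarded as a set (each equation appears once). *)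

theory Defs
  imports Complex_Main "HOL-Library.Poly_Mapping" "HOL-Algebra.Ideal"
begin

text \<open>
  All vector spaces and polynomial rings below are sets of finitely supported functions
  \<open>'k \<Rightarrow>\<^sub>0 complex\<close>, where \<open>'k\<close> indexes a basis. The complex scalar
  multiplication on them is \<open>pm_scale\<close>; linear independence, span and dimension are those of the
  library locale for vector spaces, qualified by \<open>pm\<close>.
\<close>

abbreviation "lookup \<equiv> Poly_Mapping.lookup"
abbreviation "keys \<equiv> Poly_Mapping.keys"
abbreviation "single \<equiv> Poly_Mapping.single"

definition pm_scale :: "complex \<Rightarrow> ('k \<Rightarrow>\<^sub>0 complex) \<Rightarrow> ('k \<Rightarrow>\<^sub>0 complex)" where
  "pm_scale c v = Poly_Mapping.map ((*) c) v"

lemma lookup_pm_scale [simp]: "lookup (pm_scale c v) k = c * lookup v k"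
  unfolding pm_scale_def by (simp add: Poly_Mapping.map.rep_eq when_def)

interpretation pm: vector_space "pm_scale :: complex \<Rightarrow> ('k \<Rightarrow>\<^sub>0 complex) \<Rightarrow> ('k \<Rightarrow>\<^sub>0 complex)"
  by unfold_locales
    (auto intro!: poly_mapping_eqI simp: lookup_add algebra_simps)

datatype qbasis = E nat | F nat | E0

definition qbasis_set :: "nat \<Rightarrow> qbasis set" where
  "qbasis_set n = E ` {1..n} \<union> F ` {1..n} \<union> {E0}"

definition qspace :: "nat \<Rightarrow> (qbasis \<Rightarrow>\<^sub>0 complex) set" where
  "qspace n = {v. keys v \<subseteq> qbasis_set n}"

definition qform :: "nat \<Rightarrow> (qbasis \<Rightarrow>\<^sub>0 complex) \<Rightarrow> complex" where
  "qform n v = (\<Sum>i\<in>{1..n}. lookup v (E i) * lookup v (F i)) + (lookup v E0)\<^sup>2"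

definition OGr :: "nat \<Rightarrow> (qbasis \<Rightarrow>\<^sub>0 complex) set set" where
  "OGr n = {L. L \<subseteq> qspace n \<and> pm.subspace L \<and> pm.dim L = n \<and> (\<forall>v\<in>L. qform n v = 0)}"

text \<open>
  The basis vector \<open>single S 1\<close> of the exterior algebra, for \<open>S = {i1 < \<dots> < ik}\<close>, is the wedge
  product of \<open>e_i1, \<dots>, e_ik\<close> in increasing order. The sign in the action of \<open>E i\<close> and \<open>F i\<close> comes
  from moving \<open>e_i\<close> past the factors with smaller index.
\<close>

definition spinor_space :: "nat \<Rightarrow> (nat set \<Rightarrow>\<^sub>0 complex) set" where
  "spinor_space n = {s. keys s \<subseteq> Pow {1..n}}"

fun basis_act :: "qbasis \<Rightarrow> nat set \<Rightarrow> (nat set \<Rightarrow>\<^sub>0 complex)" where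
  "basis_act (E i) S = (if i \<in> S then 0 else single (insert i S) ((-1) ^ card {j\<in>S. j < i}))"
| "basis_act (F i) S = (if i \<in> S then single (S - {i}) ((-1) ^ card {j\<in>S. j < i}) else 0)"
| "basis_act E0 S = single S ((-1) ^ card S)"

definition gen_act :: "qbasis \<Rightarrow> (nat set \<Rightarrow>\<^sub>0 complex) \<Rightarrow> (nat set \<Rightarrow>\<^sub>0 complex)" where
  "gen_act g s = (\<Sum>S\<in>keys s. pm_scale (lookup s S) (basis_act g S))"

definition clifford_act ::
    "nat \<Rightarrow> (qbasis \<Rightarrow>\<^sub>0 complex) \<Rightarrow> (nat set \<Rightarrow>\<^sub>0 complex) \<Rightarrow> (nat set \<Rightarrow>\<^sub>0 complex)" where
  "clifford_act n v s = (\<Sum>g\<in>qbasis_set n. pm_scale (lookup v g) (gen_act g s))"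

text \<open>A point of projective space is represented by the corresponding line of the vector space.\<close>

definition spin_embedding :: "nat \<Rightarrow> (qbasis \<Rightarrow>\<^sub>0 complex) set \<Rightarrow> (nat set \<Rightarrow>\<^sub>0 complex) set" where
  "spin_embedding n L = {s \<in> spinor_space n. \<forall>v\<in>L. clifford_act n v s = 0}"

text \<open>
  A polynomial is a finitely supported function on monomials, and a monomial a finitely supported
  exponent function on the index sets \<open>S\<close> of the variables \<open>x_S\<close>.
\<close>

type_synonym monom = "nat set \<Rightarrow>\<^sub>0 nat"

definition coord_ring :: "nat \<Rightarrow> (monom \<Rightarrow>\<^sub>0 complex) ring" where
  "coord_ring n = \<lparr>carrier = {f. \<forall>m\<in>keys f. keys m \<subseteq> Pow {1..n}},
     mult = (*), one = 1, zero = 0, add = (+)\<rparr>"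

definition poly_eval :: "(monom \<Rightarrow>\<^sub>0 complex) \<Rightarrow> (nat set \<Rightarrow>\<^sub>0 complex) \<Rightarrow> complex" where
  "poly_eval f s = (\<Sum>m\<in>keys f. lookup f m * (\<Prod>S\<in>keys m. lookup s S ^ lookup m S))"

text \<open>
  Vanishing at a projective point means vanishing at all its nonzero representatives, so this ideal
  is homogeneous.
\<close>

definition spinor_ideal :: "nat \<Rightarrow> (monom \<Rightarrow>\<^sub>0 complex) set" where
  "spinor_ideal n = {f \<in> carrier (coord_ring n).
     \<forall>l \<in> spin_embedding n ` OGr n. \<forall>s \<in> l - {0}. poly_eval f s = 0}"

definition monom_degree :: "monom \<Rightarrow> nat" where
  "monom_degree m = (\<Sum>S\<in>keys m. lookup m S)"

definition graded_piece :: "nat \<Rightarrow> (monom \<Rightarrow>\<^sub>0 complex) set \<Rightarrow> (monom \<Rightarrow>\<^sub>0 complex) set" where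
  "graded_piece d I = {f \<in> I. \<forall>m\<in>keys f. monom_degree m = d}"

datatype boolean_semifield = B0 | B1

instantiation boolean_semifield :: comm_semiring_1
begin

definition "0 = B0"
definition "1 = B1"
fun plus_boolean_semifield where
  "B0 + b = (b :: boolean_semifield)"
| "B1 + b = B1"
fun times_boolean_semifield where
  "B0 * b = (B0 :: boolean_semifield)"
| "B1 * b = b"

instance
proof
  fix a b c :: boolean_semifield
  show "a + b + c = a + (b + c)" by (cases a) auto
  show "a + b = b + a" by (cases a; cases b) auto
  show "0 + a = a" by (simp add: zero_boolean_semifield_def)
  show "a * b * c = a * (b * c)" by (cases a) auto
  show "a * b = b * a" by (cases a; cases b) auto
  show "1 * a = a" by (simp add: one_boolean_semifield_def)
  show "(a + b) * c = a * c + b * c" by (cases a; cases b; cases c) auto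
  show "0 * a = 0" by (simp add: zero_boolean_semifield_def)
  show "a * 0 = 0" by (cases a) (auto simp: zero_boolean_semifield_def)
  show "(0 :: boolean_semifield) \<noteq> 1"
    by (simp add: zero_boolean_semifield_def one_boolean_semifield_def)
qed

end

lemma boolean_semifield_one_add_one: "(1 :: boolean_semifield) + 1 = 1"
  by (simp add: one_boolean_semifield_def)

definition trop :: "(monom \<Rightarrow>\<^sub>0 complex) \<Rightarrow> (monom \<Rightarrow>\<^sub>0 boolean_semifield)" where
  "trop f = (\<Sum>m\<in>keys f. single m 1)"

definition trop_var :: "nat set \<Rightarrow> (monom \<Rightarrow>\<^sub>0 boolean_semifield)" where
  "trop_var S = single (single S 1) 1"

text \<open>
  The vertex \<open>\<epsilon>_S\<close> of the cube is represented by \<open>S\<close>. Antipodes are ordered pairs here; as addition of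
  Boolean polynomials is idempotent, summing over ordered or over unordered pairs is the same.
\<close>

definition antipodes :: "nat set \<Rightarrow> nat set \<Rightarrow> (nat set \<times> nat set) set" where
  "antipodes I J = {(S, T). S \<inter> T = I \<inter> J \<and> sym_diff S T = sym_diff I J}"

definition antipode_eq :: "nat set \<Rightarrow> nat set \<Rightarrow> (monom \<Rightarrow>\<^sub>0 boolean_semifield)" where
  "antipode_eq I J = (\<Sum>(S, T)\<in>antipodes I J. trop_var S * trop_var T)"

definition peerless_antipode_eqs :: "nat \<Rightarrow> (monom \<Rightarrow>\<^sub>0 boolean_semifield) set" where
  "peerless_antipode_eqs n =
     {antipode_eq I J | I J. I \<subseteq> {1..n} \<and> J \<subseteq> {1..n} \<and> 3 \<le> card (sym_diff I J)}"

lemma gen_act_superset: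
  assumes "finite A" "keys s \<subseteq> A"
  shows "gen_act g s = (\<Sum>S\<in>A. pm_scale (lookup s S) (basis_act g S))"
  unfolding gen_act_def using assms
  by (intro sum.mono_neutral_left) (auto simp: in_keys_iff)

lemma gen_act_add: "gen_act g (s + t) = gen_act g s + gen_act g t"
proof -
  have "keys (s + t) \<subseteq> keys s \<union> keys t"
    by (rule keys_add)
  then show ?thesis
    by (simp add: gen_act_superset[of "keys s \<union> keys t"] lookup_add pm.scale_left_distrib sum.distrib)
qed

lemma gen_act_scale: "gen_act g (pm_scale c s) = pm_scale c (gen_act g s)"
proof -
  have "keys (pm_scale c s) \<subseteq> keys s"
    by (auto simp: in_keys_iff)
  then show ?thesis
    by (simp add: gen_act_superset[of "keys s"] pm.scale_sum_right)
qed

lemma gen_act_0 [simp]: "gen_act g 0 = 0"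
  by (simp add: gen_act_def)

lemma gen_act_sum: "gen_act g (sum f A) = (\<Sum>a\<in>A. gen_act g (f a))"
  by (induction A rule: infinite_finite_induct) (simp_all add: gen_act_add)

lemma gen_act_single: "gen_act g (single S c) = pm_scale c (basis_act g S)"
  by (simp add: gen_act_superset[of "{S}"])

text \<open>The polar form of the quadratic form on basis vectors.\<close>

fun qpolar :: "qbasis \<Rightarrow> qbasis \<Rightarrow> complex" where
  "qpolar (E i) (F j) = (if i = j then 1 else 0)"
| "qpolar (F i) (E j) = (if i = j then 1 else 0)"
| "qpolar E0 E0 = 2"
| "qpolar _ _ = 0"

lemma pm_scale_single [simp]: "pm_scale c (single S d) = single S (c * d)"
  by (intro poly_mapping_eqI) (simp add: lookup_single when_def)

lemma sign_insert:
  fixes i j :: nat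
  assumes "i \<notin> S"
  shows "(-1 :: complex) ^ card {k. (k = i \<or> k \<in> S) \<and> k < j} =
    (if i < j then -1 else 1) * (-1) ^ card {k\<in>S. k < j}"
proof -
  have "{k. (k = i \<or> k \<in> S) \<and> k < j} = (if i < j then insert i {k\<in>S. k < j} else {k\<in>S. k < j})"
    by auto
  then show ?thesis using assms by simp
qed

lemma sign_remove:
  fixes i j :: nat
  assumes "i \<in> S"
  shows "(-1 :: complex) ^ card {k. k \<in> S \<and> k \<noteq> i \<and> k < j} =
    (if i < j then -1 else 1) * (-1) ^ card {k\<in>S. k < j}"
proof -
  have "{k. (k = i \<or> k \<in> S - {i}) \<and> k < j} = {k\<in>S. k < j}"
       "{k \<in> S - {i}. k < j} = {k. k \<in> S \<and> k \<noteq> i \<and> k < j}"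
    using assms by auto
  with sign_insert[of i "S - {i}" j] show ?thesis by simp
qed

lemma basis_act_anticommute:
  assumes S: "finite S"
  shows "gen_act g (basis_act h S) + gen_act h (basis_act g S) = single S (qpolar g h)"
proof -
  have sets: "insert i (insert j S) = insert j (insert i S)"
             "i \<noteq> j \<Longrightarrow> insert i S - {j} = insert i (S - {j})"
             "S - {i} - {j} = S - {j} - {i}" for i j :: nat
    by auto
  have minus: "single A (- c) = - single A (c :: complex)" for A :: "nat set" and c
    by (rule single_uminus)
  have square: "(-1 :: complex) ^ k * (-1) ^ k = 1" for k
    by (simp flip: power_mult_distrib)
  have cards: "(-1 :: complex) ^ card (insert i S) = - ((-1) ^ card S)" if "i \<notin> S" for i
    using that S by simp
  have cards': "(-1 :: complex) ^ card (S - {i}) = - ((-1) ^ card S)" if "i \<in> S" for i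
    using card.remove[OF S that] by simp
  show ?thesis
    by (cases g; cases h)
      (auto simp: gen_act_single sign_insert sign_remove cards cards' sets minus square insert_absorb
        mult.commute single_add[symmetric] simp del: card_insert_disjoint card_Diff_singleton card_Diff_insert)
qed

lemma gen_act_anticommute:
  assumes "s \<in> spinor_space n"
  shows "gen_act g (gen_act h s) + gen_act h (gen_act g s) = pm_scale (qpolar g h) s"
proof -
  have fin: "finite S" if "S \<in> keys s" for S
  proof -
    have "S \<subseteq> {1..n}"
      using that assms by (auto simp: spinor_space_def)
    then show ?thesis
      using finite_subset by blast
  qed
  have s: "s = (\<Sum>S\<in>keys s. single S (lookup s S))"
    by (rule poly_mapping_eqI) (simp add: lookup_sum lookup_single when_def in_keys_iff)
  have "gen_act g (gen_act h s) + gen_act h (gen_act g s) =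
      (\<Sum>S\<in>keys s. pm_scale (lookup s S) (gen_act g (basis_act h S) + gen_act h (basis_act g S)))"
    by (simp add: gen_act_def[of _ s] gen_act_sum gen_act_scale sum.distrib pm.scale_right_distrib)
  also have "\<dots> = (\<Sum>S\<in>keys s. pm_scale (qpolar g h) (single S (lookup s S)))"
    using fin by (intro sum.cong) (simp_all add: basis_act_anticommute mult.commute)
  also have "\<dots> = pm_scale (qpolar g h) s"
    by (simp only: s[symmetric] flip: pm.scale_sum_right)
  finally show ?thesis .
qed

lemma finite_qbasis_set [simp]: "finite (qbasis_set n)"
  by (simp add: qbasis_set_def)

lemma sum_qbasis_set:
  fixes f :: "qbasis \<Rightarrow> 'a :: ab_group_add"
  shows "(\<Sum>g\<in>qbasis_set n. f g) = (\<Sum>i\<in>{1..n}. f (E i)) + (\<Sum>i\<in>{1..n}. f (F i)) + f E0"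
proof -
  have "(\<Sum>g\<in>qbasis_set n. f g) = (\<Sum>g\<in>E ` {1..n}. f g) + (\<Sum>g\<in>F ` {1..n}. f g) + (\<Sum>g\<in>{E0}. f g)"
    unfolding qbasis_set_def by (subst sum.union_disjoint; (subst sum.union_disjoint)?; force)+
  then show ?thesis
    by (simp add: sum.reindex inj_on_def)
qed

lemma qpolar_qform:
  "(\<Sum>g\<in>qbasis_set n. \<Sum>h\<in>qbasis_set n. lookup v g * lookup v h * qpolar g h) = 2 * qform n v"
proof -
  have "(\<Sum>g\<in>qbasis_set n. \<Sum>h\<in>qbasis_set n. lookup v g * lookup v h * qpolar g h) =
      (\<Sum>i\<in>{1..n}. lookup v (E i) * lookup v (F i)) + (\<Sum>i\<in>{1..n}. lookup v (F i) * lookup v (E i))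
      + 2 * (lookup v E0)\<^sup>2"
    by (simp add: sum_qbasis_set if_distrib[of "(*) _"] power2_eq_square cong: if_cong)
  then show ?thesis
    by (simp add: qform_def mult.commute)
qed

lemma clifford_relation:
  assumes "s \<in> spinor_space n"
  shows "clifford_act n v (clifford_act n v s) = pm_scale (qform n v) s"
proof -
  let ?B = "qbasis_set n"
  let ?t = "\<lambda>g h. pm_scale (lookup v g * lookup v h) (gen_act g (gen_act h s))"
  let ?X = "clifford_act n v (clifford_act n v s)"
  have X: "?X = (\<Sum>g\<in>?B. \<Sum>h\<in>?B. ?t g h)"
    by (simp add: clifford_act_def gen_act_sum gen_act_scale pm.scale_sum_right)
  also have "\<dots> = (\<Sum>g\<in>?B. \<Sum>h\<in>?B. ?t h g)"
    by (rule sum.swap)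
  finally have X': "?X = (\<Sum>g\<in>?B. \<Sum>h\<in>?B. ?t h g)" .
  have "?X + ?X = (\<Sum>g\<in>?B. \<Sum>h\<in>?B. ?t g h + ?t h g)"
    by (subst (1) X, subst X') (simp add: sum.distrib)
  also have "\<dots> = (\<Sum>g\<in>?B. \<Sum>h\<in>?B. pm_scale (lookup v g * lookup v h * qpolar g h) s)"
  proof (intro sum.cong refl)
    fix g h
    have "?t g h + ?t h g =
        pm_scale (lookup v g * lookup v h) (gen_act g (gen_act h s) + gen_act h (gen_act g s))"
      by (simp only: pm.scale_right_distrib mult.commute[of "lookup v h" "lookup v g"])
    then show "?t g h + ?t h g = pm_scale (lookup v g * lookup v h * qpolar g h) s"
      by (simp only: gen_act_anticommute[OF assms] pm.scale_scale)
  qed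
  also have "\<dots> = pm_scale (2 * qform n v) s"
    by (simp only: pm.scale_sum_left flip: qpolar_qform)
  finally have "?X + ?X = pm_scale (2 * qform n v) s" .
  then show ?thesis
    by (simp add: poly_mapping_eq_iff fun_eq_iff lookup_add)
qed

lemma coord_ring_cring: "cring (coord_ring n)"
proof -
  define C where "C = {f :: monom \<Rightarrow>\<^sub>0 complex. \<forall>m\<in>keys f. keys m \<subseteq> Pow {1..n}}"
  have ring: "coord_ring n = \<lparr>carrier = C, mult = (*), one = 1, zero = 0, add = (+)\<rparr>"
    by (simp add: coord_ring_def C_def)
  have zero: "0 \<in> C" and one: "1 \<in> C"
    by (auto simp: C_def)
  have add: "f + g \<in> C" if "f \<in> C" "g \<in> C" for f g
    using that keys_add[of f g] unfolding C_def by blast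
  have mult: "f * g \<in> C" if fg: "f \<in> C" "g \<in> C" for f g
    unfolding C_def
  proof (standard, rule ballI)
    fix m assume "m \<in> keys (f * g)"
    then obtain a b where "m = a + b" "a \<in> keys f" "b \<in> keys g"
      using keys_mult[of f g] by blast
    then show "keys m \<subseteq> Pow {1..n}"
      using fg keys_add[of a b] unfolding C_def by blast
  qed
  have inv: "\<exists>g\<in>C. f + g = 0" if "f \<in> C" for f
    using that by (intro bexI[of _ "- f"]) (auto simp: C_def)
  show ?thesis
    unfolding ring
    by (intro cringI abelian_groupI comm_monoidI)
      (simp_all add: zero one add mult inv add.assoc add.commute mult.assoc mult.commute distrib_left)
qed

end

(*
  Each pair (S, T) of subsets of [n] gives a quadric: the coordinate at e_S (x) e_T of Cartan's
  relation Omega (s (x) s) = s (x) s, where Omega = sum_i 2 (e_i (x) f_i + f_i (x) e_i) + e_0 (x) e_0.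
  If s is annihilated by a maximal isotropic L and u is a unit vector orthogonal to L, then Omega
  (s (x) s) = us (x) us and us = s or us = -s, so the quadrics vanish on the variety.

  Conversely they generate the ideal. Let X_i, Y_i, X_0 be the derivations of the polynomial ring
  induced by e_i, f_i, e_0, and let Eul be the Euler derivation. The second-order operator
  2 sum_i (X_i Y_i + Y_i X_i) + X_0^2 - 2n Eul - Eul^2 kills the variables and its polar form on
  (x_S, x_T) is the quadric, so its values lie in the ideal Q of the quadrics. If f vanishes on the
  variety then so does X_i f, and X_i lowers the total size of the index sets; by induction X_i f
  lies in Q. Since Y_i preserves Q and X_i Y_i - Y_i X_i is diagonal, the operator acts on f modulo Q
  diagonally on monomials. Its only zero eigenvalues are those of the powers of the variable x_{},
  and Q is a sum of eigenspaces, so f is congruent modulo Q to a polynomial in x_{}, which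
  vanishes at the vacuum line and hence is 0.

  The quadric of (S, T) only involves the antipodes of one cube. For a cube of dimension at least 3
  every antipode monomial occurs in some quadric of that cube, so over an infinite field the elements
  of full support span, and a basis can be chosen among them; in dimension at most 2 the quadrics
  are 0.
*)
theory Submission
  imports Defs
begin

section \<open>Polynomials and derivations\<close>

type_synonym poly = "monom \<Rightarrow>\<^sub>0 complex"

abbreviation polys :: "nat \<Rightarrow> poly set" where
  "polys n \<equiv> carrier (coord_ring n)"

definition Var :: "nat set \<Rightarrow> poly" where
  "Var S = single (single S 1) 1"

lemma polys_iff: "f \<in> polys n \<longleftrightarrow> (\<forall>m\<in>keys f. keys m \<subseteq> Pow {1..n})"
  by (simp add: coord_ring_def)

lemma pm_scale_eq_mult: "pm_scale c f = single 0 c * f"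
  for f :: "'a::comm_monoid_add \<Rightarrow>\<^sub>0 complex"
  by (simp add: pm_scale_def mult_map_scale_conv_mult)

lemma pm_scale_mult_left: "pm_scale c f * g = pm_scale c (f * g)"
  for f :: "'a::comm_monoid_add \<Rightarrow>\<^sub>0 complex"
  by (simp add: pm_scale_eq_mult mult.assoc)

lemma pm_scale_mult_right: "f * pm_scale c g = pm_scale c (f * g)"
  for f :: "'a::comm_monoid_add \<Rightarrow>\<^sub>0 complex"
  by (simp add: pm_scale_eq_mult mult.left_commute)

lemma keys_pm_scale_subset: "keys (pm_scale c f) \<subseteq> keys f"
  by (auto simp: in_keys_iff)

lemma poly_mapping_sum_singles: "(\<Sum>m\<in>keys f. single m (lookup f m)) = f"
  for f :: "'a \<Rightarrow>\<^sub>0 'b::comm_monoid_add"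
  by (rule poly_mapping_eqI) (simp add: lookup_sum lookup_single when_def in_keys_iff)

lemma poly_mapping_add_induct [case_names zero single add]:
  fixes f :: "'a \<Rightarrow>\<^sub>0 'b::comm_monoid_add"
  assumes "P 0" "\<And>m c. P (single m c)" "\<And>f g. P f \<Longrightarrow> P g \<Longrightarrow> P (f + g)"
  shows "P f"
proof -
  have "P (\<Sum>m\<in>A. single m (lookup f m))" if "finite A" for A
    using that by induction (auto intro: assms)
  from this[of "keys f"] show ?thesis
    by (simp add: poly_mapping_sum_singles)
qed

lemma polys_ring_simps:
  "mult (coord_ring n) = (*)" "one (coord_ring n) = 1"
  "zero (coord_ring n) = 0" "add (coord_ring n) = (+)"
  by (simp_all add: coord_ring_def)

lemma polys_0 [simp]: "0 \<in> polys n"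
  and polys_1 [simp]: "1 \<in> polys n"
  by (auto simp: polys_iff)

lemma polys_add [intro]: "f \<in> polys n \<Longrightarrow> g \<in> polys n \<Longrightarrow> f + g \<in> polys n"
  using keys_add[of f g] unfolding polys_iff by blast

lemma polys_scale [intro]: "f \<in> polys n \<Longrightarrow> pm_scale c f \<in> polys n"
  using keys_pm_scale_subset[of c f] unfolding polys_iff by blast

lemma polys_mult [intro]: "f \<in> polys n \<Longrightarrow> g \<in> polys n \<Longrightarrow> f * g \<in> polys n"
  using cring.cring_simprules(5)[OF coord_ring_cring, of f n g] by (simp add: polys_ring_simps)

lemma polys_uminus [intro]: "f \<in> polys n \<Longrightarrow> - f \<in> polys n"
  by (simp add: polys_iff)

lemma polys_diff [intro]: "f \<in> polys n \<Longrightarrow> g \<in> polys n \<Longrightarrow> f - g \<in> polys n"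
  using polys_add[of f n "- g"] by auto

lemma polys_sum [intro]: "(\<And>i. i \<in> A \<Longrightarrow> f i \<in> polys n) \<Longrightarrow> sum f A \<in> polys n"
  by (induction A rule: infinite_finite_induct) auto

lemma polys_Var [simp]: "Var S \<in> polys n \<longleftrightarrow> S \<subseteq> {1..n}"
  by (simp add: polys_iff Var_def)

lemma polys_single: "single m c \<in> polys n" if "keys m \<subseteq> Pow {1..n}"
  using that by (auto simp: polys_iff)

lemma Var_power: "Var S ^ k = single (single S k) 1"
  by (induction k) (simp_all add: Var_def mult_single single_add[symmetric])

text \<open>Treats \<open>polys n\<close> as the algebra generated by the variables, so that
  statements about derivations and biderivations need checking on \<open>Var S\<close> only.\<close>

lemma polys_induct [consumes 1, case_names one Var add mult scale]:
  assumes "f \<in> polys n"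
    and one: "P 1"
    and Var: "\<And>S. S \<subseteq> {1..n} \<Longrightarrow> P (Var S)"
    and add: "\<And>f g. f \<in> polys n \<Longrightarrow> g \<in> polys n \<Longrightarrow> P f \<Longrightarrow> P g \<Longrightarrow> P (f + g)"
    and mult: "\<And>f g. f \<in> polys n \<Longrightarrow> g \<in> polys n \<Longrightarrow> P f \<Longrightarrow> P g \<Longrightarrow> P (f * g)"
    and scale: "\<And>c f. f \<in> polys n \<Longrightarrow> P f \<Longrightarrow> P (pm_scale c f)"
  shows "P f"
proof -
  let ?Q = "\<lambda>f. f \<in> polys n \<and> P f"
  have pow: "?Q (Var S ^ k)" if "S \<subseteq> {1..n}" for S k
  proof (induction k)
    case (Suc k)
    have "P (Var S * Var S ^ k)"
      using Suc that by (intro mult Var) simp_all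
    then show ?case
      using Suc that polys_Var[of S n] by (auto simp del: polys_Var)
  qed (simp add: one)
  have mon: "?Q (single m 1)" if m: "keys m \<subseteq> Pow {1..n}" for m
  proof -
    have "?Q (single (\<Sum>S\<in>A. single S (lookup m S)) 1)" if "A \<subseteq> keys m" for A
      using finite_subset[OF that finite_keys] that
    proof induction
      case empty
      then show ?case using one by simp
    next
      case (insert S A)
      have "single (\<Sum>S\<in>insert S A. single S (lookup m S)) 1
        = Var S ^ lookup m S * single (\<Sum>S\<in>A. single S (lookup m S)) 1"
        using insert.hyps by (simp add: Var_power mult_single)
      then show ?case
        using insert pow[of S "lookup m S"] m mult by auto
    qed
    from this[of "keys m"] show ?thesis
      by (simp add: poly_mapping_sum_singles)
  qed
  have "?Q (\<Sum>m\<in>A. single m (lookup f m))" if "A \<subseteq> keys f" for A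
    using finite_subset[OF that finite_keys] that
  proof induction
    case empty
    have "P (pm_scale 0 1)" by (rule scale) (simp_all add: one)
    then show ?case by simp
  next
    case (insert m A)
    have "?Q (single m 1)"
      using insert.prems assms(1) by (intro mon) (auto simp: polys_iff)
    then have "?Q (pm_scale (lookup f m) (single m 1))"
      using scale by blast
    then show ?case
      using insert add by auto
  qed
  from this[of "keys f"] show ?thesis
    by (simp add: poly_mapping_sum_singles)
qed

section \<open>Evaluation of polynomials\<close>

definition eval_mon :: "(nat set \<Rightarrow>\<^sub>0 complex) \<Rightarrow> monom \<Rightarrow> complex" where
  "eval_mon s m = (\<Prod>S\<in>keys m. lookup s S ^ lookup m S)"

lemma eval_mon_superset:
  "finite A \<Longrightarrow> keys m \<subseteq> A \<Longrightarrow> eval_mon s m = (\<Prod>S\<in>A. lookup s S ^ lookup m S)"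
  unfolding eval_mon_def by (intro prod.mono_neutral_left) (auto simp: in_keys_iff)

lemma eval_mon_add: "eval_mon s (m + m') = eval_mon s m * eval_mon s m'"
proof -
  have "keys (m + m') \<subseteq> keys m \<union> keys m'"
    by (rule keys_add)
  then show ?thesis
    by (simp add: eval_mon_superset[of "keys m \<union> keys m'"] lookup_add power_add prod.distrib)
qed

lemma poly_eval_superset:
  "finite A \<Longrightarrow> keys f \<subseteq> A \<Longrightarrow> poly_eval f s = (\<Sum>m\<in>A. lookup f m * eval_mon s m)"
  unfolding poly_eval_def eval_mon_def by (intro sum.mono_neutral_left) (auto simp: in_keys_iff)

lemma poly_eval_0 [simp]: "poly_eval 0 s = 0"
  by (simp add: poly_eval_def)

lemma poly_eval_add [simp]: "poly_eval (f + g) s = poly_eval f s + poly_eval g s"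
proof -
  have "keys (f + g) \<subseteq> keys f \<union> keys g"
    by (rule keys_add)
  then show ?thesis
    by (simp add: poly_eval_superset[of "keys f \<union> keys g"] lookup_add algebra_simps sum.distrib)
qed

lemma poly_eval_single: "poly_eval (single m c) s = c * eval_mon s m"
  by (simp add: poly_eval_superset[of "{m}"])

lemma poly_eval_scale [simp]: "poly_eval (pm_scale c f) s = c * poly_eval f s"
  using keys_pm_scale_subset[of c f]
  by (simp add: poly_eval_superset[of "keys f"] sum_distrib_left mult.assoc)

lemma poly_eval_uminus [simp]: "poly_eval (- f) s = - poly_eval f s"
  using poly_eval_scale[of "-1" f s] by simp

lemma poly_eval_diff [simp]: "poly_eval (f - g) s = poly_eval f s - poly_eval g s"
  using poly_eval_add[of f "- g" s] by simp

lemma poly_eval_sum [simp]: "poly_eval (sum f A) s = (\<Sum>i\<in>A. poly_eval (f i) s)"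
  by (induction A rule: infinite_finite_induct) simp_all

lemma poly_eval_mult [simp]: "poly_eval (f * g) s = poly_eval f s * poly_eval g s"
proof (induction f rule: poly_mapping_add_induct)
  case (single m c)
  show ?case
    by (induction g rule: poly_mapping_add_induct)
      (simp_all add: mult_single poly_eval_single eval_mon_add distrib_left)
qed (simp_all add: distrib_right)

lemma poly_eval_1 [simp]: "poly_eval 1 s = 1"
  by (simp add: poly_eval_single eval_mon_def flip: single_one)

lemma poly_eval_Var [simp]: "poly_eval (Var S) s = lookup s S"
  by (simp add: poly_eval_single eval_mon_def Var_def)

section \<open>Derivations given by their values on the variables\<close>

definition der_mon :: "(nat set \<Rightarrow> poly) \<Rightarrow> monom \<Rightarrow> poly" where
  "der_mon \<phi> m = (\<Sum>S\<in>keys m. pm_scale (of_nat (lookup m S)) (single (m - single S 1) 1 * \<phi> S))"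

definition der :: "(nat set \<Rightarrow> poly) \<Rightarrow> poly \<Rightarrow> poly" where
  "der \<phi> f = (\<Sum>m\<in>keys f. pm_scale (lookup f m) (der_mon \<phi> m))"

lemma der_mon_superset:
  "finite A \<Longrightarrow> keys m \<subseteq> A \<Longrightarrow>
    der_mon \<phi> m = (\<Sum>S\<in>A. pm_scale (of_nat (lookup m S)) (single (m - single S 1) 1 * \<phi> S))"
  unfolding der_mon_def by (intro sum.mono_neutral_left) (auto simp: in_keys_iff)

lemma der_superset:
  "finite A \<Longrightarrow> keys f \<subseteq> A \<Longrightarrow> der \<phi> f = (\<Sum>m\<in>A. pm_scale (lookup f m) (der_mon \<phi> m))"
  unfolding der_def by (intro sum.mono_neutral_left) (auto simp: in_keys_iff)

lemma der_0 [simp]: "der \<phi> 0 = 0"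
  by (simp add: der_def)

lemma der_add: "der \<phi> (f + g) = der \<phi> f + der \<phi> g"
proof -
  have "keys (f + g) \<subseteq> keys f \<union> keys g"
    by (rule keys_add)
  then show ?thesis
    by (simp add: der_superset[of "keys f \<union> keys g"] lookup_add pm.scale_left_distrib sum.distrib)
qed

lemma der_scale: "der \<phi> (pm_scale c f) = pm_scale c (der \<phi> f)"
  using keys_pm_scale_subset[of c f]
  by (simp add: der_superset[of "keys f"] pm.scale_sum_right)

lemma der_uminus: "der \<phi> (- f) = - der \<phi> f"
  using der_scale[of \<phi> "-1" f] by simp

lemma der_diff: "der \<phi> (f - g) = der \<phi> f - der \<phi> g"
  using der_add[of \<phi> f "- g"] by (simp add: der_uminus)

lemma der_sum: "der \<phi> (sum f A) = (\<Sum>i\<in>A. der \<phi> (f i))"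
  by (induction A rule: infinite_finite_induct) (simp_all add: der_add)

lemma der_single: "der \<phi> (single m c) = pm_scale c (der_mon \<phi> m)"
  by (simp add: der_superset[of "{m}"])

lemma der_mon_add: "der_mon \<phi> (m + m') = der_mon \<phi> m * single m' 1 + single m 1 * der_mon \<phi> m'"
proof -
  let ?A = "keys m \<union> keys m'"
  \<comment> \<open>Exponent subtraction is truncated, so this needs \<open>S\<close> to occur in
    \<open>m\<close>; otherwise the coefficient \<open>lookup m S\<close> is 0 and kills the
    term.\<close>
  have shift: "single (m + m' - single S 1) (1::complex) = single (m - single S 1) 1 * single m' 1"
    if "lookup m S \<noteq> 0" for m m' :: monom and S
  proof -
    have "m + m' - single S 1 = (m - single S 1) + m'"
      using that
      by (intro poly_mapping_eqI) (auto simp: lookup_add lookup_minus lookup_single when_def)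
    then show ?thesis
      by (simp add: mult_single)
  qed
  have left: "pm_scale (of_nat (lookup m S)) (single (m + m' - single S 1) 1 * \<phi> S)
    = pm_scale (of_nat (lookup m S)) (single (m - single S 1) 1 * \<phi> S) * single m' 1"
    for m m' :: monom and S
    by (cases "lookup m S = 0") (simp_all add: shift[unfolded One_nat_def] pm_scale_mult_left pm_scale_mult_right mult_ac)
  have right: "pm_scale (of_nat (lookup m' S)) (single (m + m' - single S 1) 1 * \<phi> S)
    = single m 1 * pm_scale (of_nat (lookup m' S)) (single (m' - single S 1) 1 * \<phi> S)"
    for S
    using left[of m' S m] by (simp add: add.commute mult.commute)
  have "keys (m + m') \<subseteq> ?A"
    by (rule keys_add)
  then have "der_mon \<phi> (m + m') = (\<Sum>S\<in>?A. pm_scale (of_nat (lookup m S)) (single (m + m' - single S 1) 1 * \<phi> S)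
      + pm_scale (of_nat (lookup m' S)) (single (m + m' - single S 1) 1 * \<phi> S))"
    by (simp add: der_mon_superset[of ?A] lookup_add pm.scale_left_distrib)
  also have "\<dots> = der_mon \<phi> m * single m' 1 + single m 1 * der_mon \<phi> m'"
    by (simp only: left right sum.distrib der_mon_superset[of ?A m] der_mon_superset[of ?A m']
        finite_Un finite_keys Un_upper1 Un_upper2 simp_thms sum_distrib_left sum_distrib_right)
  finally show ?thesis .
qed

lemma der_mult: "der \<phi> (f * g) = der \<phi> f * g + f * der \<phi> g"
proof (induction f rule: poly_mapping_add_induct)
  case (single m c)
  have split: "single m c = pm_scale c (single m 1)" for m :: monom and c
    by simp
  show ?case
  proof (induction g rule: poly_mapping_add_induct)
    case (single m' d)
    show ?case
      unfolding split[of m c] split[of m' d] pm_scale_mult_left pm_scale_mult_right der_scale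
      by (simp add: der_single der_mon_add mult_single pm.scale_right_distrib mult.commute
          pm_scale_mult_left pm_scale_mult_right del: pm_scale_single)
  qed (simp_all add: distrib_left der_add algebra_simps)
qed (simp_all add: distrib_right der_add algebra_simps)

lemma der_1 [simp]: "der \<phi> 1 = 0"
  by (simp add: der_mon_def der_single flip: single_one)

lemma der_Var [simp]: "der \<phi> (Var S) = \<phi> S"
  by (simp add: Var_def der_single der_mon_def)

lemma der_polys:
  assumes "f \<in> polys n" "\<And>S. S \<subseteq> {1..n} \<Longrightarrow> \<phi> S \<in> polys n"
  shows "der \<phi> f \<in> polys n"
  using assms(1) by (induction rule: polys_induct) (auto simp: der_add der_mult der_scale assms(2))

lemma derivation_unique:
  assumes "f \<in> polys n"
    and "\<And>f g. D (f + g) = D f + D g" "\<And>c f. D (pm_scale c f) = pm_scale c (D f)"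
    and mult: "\<And>f g. D (f * g) = D f * g + f * D g"
    and "\<And>S. S \<subseteq> {1..n} \<Longrightarrow> D (Var S) = \<phi> S"
  shows "D f = der \<phi> f"
  using assms(1)
proof (induction rule: polys_induct)
  case one
  show ?case using mult[of 1 1] by simp
qed (simp_all add: assms der_add der_scale der_mult)

text \<open>Chain rule: when the coordinates move with velocity \<phi>, the value of
  \<open>f\<close> moves with velocity \<open>der \<phi> f\<close>. It serves to differentiate along
  curves of pure spinors.\<close>

lemma poly_eval_has_derivative:
  assumes "f \<in> polys n"
    and "\<And>S. S \<subseteq> {1..n} \<Longrightarrow>
      ((\<lambda>t. lookup (\<gamma> t) S) has_field_derivative poly_eval (\<phi> S) (\<gamma> t0)) (at t0)"
  shows "((\<lambda>t. poly_eval f (\<gamma> t)) has_field_derivative poly_eval (der \<phi> f) (\<gamma> t0)) (at t0)"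
  using assms(1)
proof (induction rule: polys_induct)
  case (mult f g)
  from DERIV_mult[OF mult.IH] show ?case
    by (simp add: der_mult algebra_simps)
next
  case (scale c f)
  from DERIV_cmult[OF scale.IH, of c] show ?case
    by (simp add: der_scale)
qed (auto simp: der_add assms(2) intro: DERIV_add)

lemma der_diagonal_single:
  "der (\<lambda>S. pm_scale (w S) (Var S)) (single m c)
    = single m (c * (\<Sum>S\<in>keys m. of_nat (lookup m S) * w S))"
proof -
  have shift: "m - single S (1::nat) + single S 1 = m" if "S \<in> keys m" for S
    using that
    by (intro poly_mapping_eqI) (auto simp: lookup_add lookup_minus lookup_single when_def in_keys_iff)
  have sums: "(\<Sum>S\<in>A. single m (h S)) = single m (\<Sum>S\<in>A. h S)" for h :: "nat set \<Rightarrow> complex" and A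
    by (induction A rule: infinite_finite_induct) (simp_all add: single_add)
  have "der_mon (\<lambda>S. pm_scale (w S) (Var S)) m = (\<Sum>S\<in>keys m. single m (of_nat (lookup m S) * w S))"
    unfolding der_mon_def
    by (intro sum.cong refl) (simp add: Var_def mult_single shift[unfolded One_nat_def] shift)
  then show ?thesis
    by (simp add: der_single sums)
qed

section \<open>The Clifford action on coordinates and the quadrics\<close>

text \<open>Transpose of the Clifford generators: \<open>coord_act g S\<close> is the linear form
  taking a spinor s to the coordinate of g s at \<open>S\<close>. Extended as a derivation, it
  differentiates a polynomial in the direction g s.\<close>

fun coord_act :: "qbasis \<Rightarrow> nat set \<Rightarrow> poly" where
  "coord_act (E i) S = (if i \<in> S then pm_scale ((-1) ^ card {j\<in>S. j < i}) (Var (S - {i})) else 0)"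
| "coord_act (F i) S = (if i \<in> S then 0 else pm_scale ((-1) ^ card {j\<in>S. j < i}) (Var (insert i S)))"
| "coord_act E0 S = pm_scale ((-1) ^ card S) (Var S)"

lemma poly_eval_coord_act: "poly_eval (coord_act g S) s = lookup (gen_act g s) S"
proof -
  have single: "lookup (single T (c::complex)) S = (if S = T then c else 0)" for T c
    by (simp add: lookup_single when_def)
  have pick: "(\<Sum>T\<in>keys s. if T = U then lookup s T * c else 0) = lookup s U * c" for U c
    by (simp add: in_keys_iff)
  have "lookup s T * lookup (basis_act g T) S =
      (case g of
        E i \<Rightarrow> if T = S - {i} then lookup s T * (if i \<in> S then (-1) ^ card {j\<in>S. j < i} else 0) else 0
      | F i \<Rightarrow> if T = insert i S then lookup s T * (if i \<notin> S then (-1) ^ card {j\<in>S. j < i} else 0) else 0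
      | E0 \<Rightarrow> if T = S then lookup s T * (-1) ^ card S else 0)" for T
  proof (cases g)
    case (E i)
    have "{j \<in> S - {i}. j < i} = {j \<in> S. j < i}" by auto
    then show ?thesis
      using E by (auto simp: single)
  next
    case (F i)
    have "{j \<in> insert i S. j < i} = {j \<in> S. j < i}" by auto
    then show ?thesis
      using F by (auto simp: single simp del: Collect_conj_eq)
  qed (auto simp: single)
  then have "lookup (gen_act g s) S = (\<Sum>T\<in>keys s.
      (case g of
        E i \<Rightarrow> if T = S - {i} then lookup s T * (if i \<in> S then (-1) ^ card {j\<in>S. j < i} else 0) else 0
      | F i \<Rightarrow> if T = insert i S then lookup s T * (if i \<notin> S then (-1) ^ card {j\<in>S. j < i} else 0) else 0
      | E0 \<Rightarrow> if T = S then lookup s T * (-1) ^ card S else 0))"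
    by (simp add: gen_act_def lookup_sum)
  then show ?thesis
    by (cases g) (simp_all add: pick)
qed

lemma coord_act_polys:
  assumes "S \<subseteq> {1..n}" "g \<in> qbasis_set n"
  shows "coord_act g S \<in> polys n"
  using assms by (cases g) (auto simp: qbasis_set_def intro!: polys_scale)

abbreviation act :: "qbasis \<Rightarrow> poly \<Rightarrow> poly" where
  "act g \<equiv> der (coord_act g)"

abbreviation euler :: "poly \<Rightarrow> poly" where
  "euler \<equiv> der Var"

lemma act_polys: "f \<in> polys n \<Longrightarrow> g \<in> qbasis_set n \<Longrightarrow> act g f \<in> polys n"
  by (rule der_polys) (blast intro: coord_act_polys)+

lemma euler_polys: "f \<in> polys n \<Longrightarrow> euler f \<in> polys n"
  by (rule der_polys) auto

lemma qbasis_set_memb [simp]: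
  "E i \<in> qbasis_set n \<longleftrightarrow> i \<in> {1..n}" "F i \<in> qbasis_set n \<longleftrightarrow> i \<in> {1..n}" "E0 \<in> qbasis_set n"
  by (auto simp: qbasis_set_def)

lemma pm_scale_two: "pm_scale 2 f = f * 2" for f :: poly
  by (simp add: pm_scale_eq_mult mult.commute)

text \<open>Transposition reverses products, but the Clifford relations are symmetric in
  \<open>g\<close> and \<open>h\<close> and survive it. They concern linear forms: on products the
  derivations do not satisfy them in general.\<close>

lemma act_anticommute:
  assumes S: "finite S"
  shows "act g (coord_act h S) + act h (coord_act g S) = pm_scale (qpolar g h) (Var S)"
proof -
  have sets: "insert i (insert j S) = insert j (insert i S)"
             "i \<noteq> j \<Longrightarrow> insert i S - {j} = insert i (S - {j})"
             "S - {i} - {j} = S - {j} - {i}" for i j :: nat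
    by auto
  have square: "(-1 :: complex) ^ k * (-1) ^ k = 1" for k
    by (simp flip: power_mult_distrib)
  have cards: "(-1 :: complex) ^ card (insert i S) = - ((-1) ^ card S)" if "i \<notin> S" for i
    using that S by simp
  have cards': "(-1 :: complex) ^ card (S - {i}) = - ((-1) ^ card S)" if "i \<in> S" for i
    using card.remove[OF S that] by simp
  show ?thesis
    by (cases g; cases h)
      (auto simp: der_scale pm_scale_two sign_insert sign_remove cards cards' sets square insert_absorb
        mult.commute pm.scale_left_distrib[symmetric]
        simp del: card_insert_disjoint card_Diff_singleton card_Diff_insert)
qed

lemma act_coord_act_swap:
  assumes "finite S"
  shows "act g (coord_act h S) = pm_scale (qpolar g h) (Var S) - act h (coord_act g S)"
  using act_anticommute[OF assms, of g h] by (simp add: eq_diff_eq)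

lemma euler_coord_act [simp]: "euler (coord_act g S) = coord_act g S"
  by (cases g) (simp_all add: der_scale)

section \<open>The quadrics and the ideal they generate\<close>

text \<open>Symmetric and a derivation in each argument. On variables it is a coordinate of Omega (s
  (x) s) - s (x) s; the Euler derivations extend the last tensor to a biderivation.\<close>

definition casimir_form :: "nat \<Rightarrow> poly \<Rightarrow> poly \<Rightarrow> poly" where
  "casimir_form n f g =
     pm_scale 2 (\<Sum>i\<in>{1..n}. act (E i) f * act (F i) g + act (F i) f * act (E i) g)
     + act E0 f * act E0 g - euler f * euler g"

abbreviation quadric :: "nat \<Rightarrow> nat set \<Rightarrow> nat set \<Rightarrow> poly" where
  "quadric n S T \<equiv> casimir_form n (Var S) (Var T)"

lemma casimir_form_commute: "casimir_form n f g = casimir_form n g f"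
  by (simp add: casimir_form_def mult.commute add.commute)

lemma casimir_form_1 [simp]: "casimir_form n 1 g = 0"
  by (simp add: casimir_form_def)

lemma casimir_form_add: "casimir_form n (f + f') g = casimir_form n f g + casimir_form n f' g"
  by (simp add: casimir_form_def der_add distrib_right distrib_left sum.distrib pm.scale_right_distrib)

lemma casimir_form_scale: "casimir_form n (pm_scale c f) g = pm_scale c (casimir_form n f g)"
  by (simp add: casimir_form_def der_scale pm_scale_mult_left pm.scale_sum_right
      pm.scale_right_distrib pm.scale_right_diff_distrib mult.commute[of c])

lemma casimir_form_mult:
  "casimir_form n (f * f') g = f * casimir_form n f' g + casimir_form n f g * f'"
  by (simp add: casimir_form_def der_mult pm_scale_eq_mult algebra_simps sum.distrib
      sum_distrib_left sum_distrib_right)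

text \<open>Encoded as the complex span of the monomial multiples of the quadrics, so that linear
  maps and projections can be checked on these elements.\<close>

definition quadric_ideal :: "nat \<Rightarrow> poly set" where
  "quadric_ideal n = pm.span {single m 1 * quadric n S T | m S T.
     keys m \<subseteq> Pow {1..n} \<and> S \<subseteq> {1..n} \<and> T \<subseteq> {1..n}}"

lemma subspace_quadric_ideal: "pm.subspace (quadric_ideal n)"
  by (simp add: quadric_ideal_def)

lemma quadric_ideal_mult:
  assumes f: "f \<in> polys n" and q: "q \<in> quadric_ideal n"
  shows "f * q \<in> quadric_ideal n"
proof -
  have mon: "single m 1 * q \<in> quadric_ideal n" if m: "keys m \<subseteq> Pow {1..n}" for m
    using q unfolding quadric_ideal_def
  proof (induction rule: pm.span_induct_alt)
    case (step c x y)
    then obtain m' S T where x: "x = single m' 1 * quadric n S T"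
      and *: "keys m' \<subseteq> Pow {1..n}" "S \<subseteq> {1..n}" "T \<subseteq> {1..n}"
      by blast
    have "single m 1 * x = single (m + m') 1 * quadric n S T"
      by (simp add: x mult_single flip: mult.assoc)
    moreover have "keys (m + m') \<subseteq> Pow {1..n}"
      using keys_add[of m m'] m *(1) by blast
    ultimately show ?case
      unfolding distrib_left pm_scale_mult_right using * step.IH
      by (intro pm.span_add pm.span_scale) (auto intro: pm.span_base)
  qed (simp add: pm.span_zero)
  have "f * q = (\<Sum>m\<in>keys f. pm_scale (lookup f m) (single m 1)) * q"
    by (simp add: poly_mapping_sum_singles)
  also have "\<dots> = (\<Sum>m\<in>keys f. pm_scale (lookup f m) (single m 1 * q))"
    by (simp only: sum_distrib_right pm_scale_mult_left)
  also have "\<dots> \<in> quadric_ideal n"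
    using f mon
    by (intro pm.subspace_sum pm.subspace_scale subspace_quadric_ideal) (auto simp: polys_iff)
  finally show ?thesis .
qed

lemma quadric_in_quadric_ideal:
  assumes "S \<subseteq> {1..n}" "T \<subseteq> {1..n}"
  shows "quadric n S T \<in> quadric_ideal n"
proof -
  have "single 0 1 * quadric n S T \<in> quadric_ideal n"
    unfolding quadric_ideal_def using assms by (intro pm.span_base CollectI exI[of _ 0] exI[of _ S] exI[of _ T]) simp
  then show ?thesis by simp
qed

text \<open>A biderivation is determined by its values on pairs of variables, so an induction in
  each argument reduces the claim to the quadrics.\<close>

lemma casimir_form_in_quadric_ideal:
  assumes "f \<in> polys n" "g \<in> polys n"
  shows "casimir_form n f g \<in> quadric_ideal n"
proof -
  note [intro] = pm.subspace_add[OF subspace_quadric_ideal] pm.subspace_scale[OF subspace_quadric_ideal]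
    quadric_ideal_mult
  have zero: "0 \<in> quadric_ideal n"
    by (rule pm.subspace_0[OF subspace_quadric_ideal])
  have Var: "casimir_form n (Var S) g \<in> quadric_ideal n" if "S \<subseteq> {1..n}" for S
    using assms(2) unfolding casimir_form_commute[of n "Var S"]
  proof (induction rule: polys_induct)
    case (Var T)
    then show ?case
      using that by (intro quadric_in_quadric_ideal)
  qed (auto simp: zero casimir_form_add casimir_form_scale casimir_form_mult
        mult.commute[of "casimir_form _ _ _"])
  show ?thesis using assms(1)
    by (induction rule: polys_induct)
      (auto simp: zero Var casimir_form_add casimir_form_scale casimir_form_mult
        mult.commute[of "casimir_form _ _ _"])
qed

text \<open>
  On linear forms the derivations satisfy the Clifford relations, so \<open>act (F k)\<close> anticommutes with
  the tensor underlying \<open>casimir_form\<close>.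
\<close>

lemma act_F_quadric:
  assumes "k \<in> {1..n}" "finite S" "finite T"
  shows "act (F k) (quadric n S T)
    = - casimir_form n (coord_act (F k) S) (Var T) - casimir_form n (Var S) (coord_act (F k) T)"
proof -
  \<comment> \<open>Moving \<open>act (F k)\<close> past a generator changes the sign; only
    \<open>E k\<close> leaves an extra variable, as \<open>F k\<close> is orthogonal to all other
    generators.\<close>
  have *: "act (F k) (coord_act (E i) U) = (if i = k then Var U else 0) - act (E i) (coord_act (F k) U)"
      "act (F k) (coord_act (F i) U) = - act (F i) (coord_act (F k) U)"
      "act (F k) (coord_act E0 U) = - act E0 (coord_act (F k) U)" if "finite U" for i U
    using that by (simp_all only: act_coord_act_swap[of _ "F k"]) auto
  let ?x = "Var S" and ?y = "Var T" and ?vx = "coord_act (F k) S" and ?vy = "coord_act (F k) T"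
  have "(\<Sum>i\<in>{1..n}. act (F k) (coord_act (E i) S * coord_act (F i) T + coord_act (F i) S * coord_act (E i) T))
    = (\<Sum>i\<in>{1..n}. (if i = k then ?x * coord_act (F i) T + coord_act (F i) S * ?y else 0)
      - (act (E i) ?vx * coord_act (F i) T + act (F i) ?vx * coord_act (E i) T)
      - (coord_act (E i) S * act (F i) ?vy + coord_act (F i) S * act (E i) ?vy))"
    by (intro sum.cong refl) (simp add: der_add der_mult * assms algebra_simps del: coord_act.simps)
  also have "\<dots> = ?x * ?vy + ?vx * ?y
      - (\<Sum>i\<in>{1..n}. act (E i) ?vx * coord_act (F i) T + act (F i) ?vx * coord_act (E i) T)
      - (\<Sum>i\<in>{1..n}. coord_act (E i) S * act (F i) ?vy + coord_act (F i) S * act (E i) ?vy)"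
    using assms(1) by (simp only: sum_subtractf sum.delta finite_atLeastAtMost if_True)
  finally have sum: "act (F k) (\<Sum>i\<in>{1..n}. coord_act (E i) S * coord_act (F i) T + coord_act (F i) S * coord_act (E i) T)
      = ?x * ?vy + ?vx * ?y
      - (\<Sum>i\<in>{1..n}. act (E i) ?vx * coord_act (F i) T + act (F i) ?vx * coord_act (E i) T)
      - (\<Sum>i\<in>{1..n}. coord_act (E i) S * act (F i) ?vy + coord_act (F i) S * act (E i) ?vy)"
    by (simp only: der_sum)
  have two: "pm_scale 2 f = f + f" for f :: poly
    using pm.scale_left_distrib[of 1 1 f] by simp
  \<comment> \<open>The extra terms contribute twice \<open>?x * ?vy + ?vx * ?y\<close>.
    Differentiating the Euler part subtracts this once; what remains is the Euler part of the
    right-hand side.\<close>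
  show ?thesis
    unfolding casimir_form_def der_add der_diff der_scale der_Var euler_coord_act sum
    by (simp only: der_mult der_Var * assms two) (simp add: algebra_simps del: coord_act.simps)
qed

text \<open>Leibniz rule on a monomial times a quadric: the derivative of the quadric is again a
  combination of values of \<open>casimir_form\<close>.\<close>

lemma act_F_quadric_ideal:
  assumes k: "k \<in> {1..n}" and q: "q \<in> quadric_ideal n"
  shows "act (F k) q \<in> quadric_ideal n"
  using q unfolding quadric_ideal_def
proof (induction rule: pm.span_induct_alt)
  case base
  show ?case by (simp add: pm.span_zero)
next
  case (step c x y)
  then obtain m S T where x: "x = single m 1 * quadric n S T"
    and m: "keys m \<subseteq> Pow {1..n}" and ST: "S \<subseteq> {1..n}" "T \<subseteq> {1..n}"
    by blast
  have fin: "finite S" "finite T"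
    using ST finite_subset by blast+
  have pm: "single m 1 \<in> polys n"
    using m by (rule polys_single)
  have "act (F k) x \<in> quadric_ideal n"
    unfolding x der_mult act_F_quadric[OF k fin] using k pm ST
    by (intro pm.subspace_add pm.subspace_diff pm.subspace_neg subspace_quadric_ideal quadric_ideal_mult
        quadric_in_quadric_ideal casimir_form_in_quadric_ideal coord_act_polys act_polys)
      auto
  moreover have "act (F k) y \<in> quadric_ideal n"
    unfolding quadric_ideal_def by (rule step.IH)
  ultimately have "act (F k) (pm_scale c x + y) \<in> quadric_ideal n"
    unfolding der_add der_scale
    by (intro pm.subspace_add pm.subspace_scale subspace_quadric_ideal)
  then show ?case
    unfolding quadric_ideal_def .
qed

section \<open>The Casimir operator\<close>

definition casimir :: "nat \<Rightarrow> poly \<Rightarrow> poly" where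
  "casimir n f =
     pm_scale 2 (\<Sum>i\<in>{1..n}. act (E i) (act (F i) f) + act (F i) (act (E i) f))
     + act E0 (act E0 f) - pm_scale (2 * of_nat n) (euler f) - euler (euler f)"

text \<open>A second-order operator without constant term fails the Leibniz rule by twice its polar
  form.\<close>

lemma casimir_mult:
  "casimir n (f * g) = casimir n f * g + f * casimir n g + pm_scale 2 (casimir_form n f g)"
proof -
  have two: "pm_scale 2 f = f + f" for f :: poly
    using pm.scale_left_distrib[of 1 1 f] by simp
  show ?thesis
    by (simp add: casimir_def casimir_form_def der_mult der_add two
        pm_scale_mult_left pm_scale_mult_right pm.scale_right_distrib algebra_simps sum.distrib sum_distrib_left sum_distrib_right)
qed

lemma casimir_add: "casimir n (f + g) = casimir n f + casimir n g"
  by (simp add: casimir_def der_add pm.scale_right_distrib sum.distrib algebra_simps)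

lemma casimir_scale: "casimir n (pm_scale c f) = pm_scale c (casimir n f)"
  by (simp add: casimir_def der_scale pm.scale_right_distrib pm.scale_right_diff_distrib
      pm.scale_sum_right mult_ac)

text \<open>The constants cancel: the Clifford relations turn the sum over \<open>i\<close> into
  \<open>n\<close> times the variable, and \<open>E0\<close> squares to the identity, against
  \<open>2 * n\<close> and 1 from the Euler terms.\<close>

lemma casimir_Var:
  assumes "finite S"
  shows "casimir n (Var S) = 0"
proof -
  have sum: "(\<Sum>i\<in>A. f) = pm_scale (of_nat (card A)) f" for A :: "nat set" and f :: poly
    by (induction A rule: infinite_finite_induct) (simp_all add: pm.scale_left_distrib del: sum_constant)
  have "(\<Sum>i\<in>{1..n}. act (E i) (act (F i) (Var S)) + act (F i) (act (E i) (Var S)))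
      = pm_scale (of_nat n) (Var S)"
    using act_anticommute[OF assms, of "E _" "F _"] by (simp add: sum del: sum_constant)
  moreover have "act E0 (act E0 (Var S)) = Var S"
    by (simp add: der_scale flip: power_mult_distrib)
  ultimately show ?thesis
    by (simp add: casimir_def)
qed

lemma casimir_in_quadric_ideal:
  assumes "f \<in> polys n"
  shows "casimir n f \<in> quadric_ideal n"
  using assms
proof (induction rule: polys_induct)
  case one
  show ?case using pm.subspace_0[OF subspace_quadric_ideal] by (simp add: casimir_def)
next
  case (Var S)
  then show ?case
    using pm.subspace_0[OF subspace_quadric_ideal] casimir_Var[OF finite_subset[OF Var]] by simp
next
  case (add f g)
  then show ?case
    by (simp add: casimir_add pm.subspace_add[OF subspace_quadric_ideal])
next
  case (mult f g)
  then show ?case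
    unfolding casimir_mult mult.commute[of "casimir n f"]
    by (intro pm.subspace_add pm.subspace_scale subspace_quadric_ideal quadric_ideal_mult
        casimir_form_in_quadric_ideal)
next
  case (scale c f)
  then show ?case
    by (simp add: casimir_scale pm.subspace_scale[OF subspace_quadric_ideal])
qed

text \<open>A commutator of derivations is a derivation, hence determined on the variables, where
  exactly one of the two compositions is nonzero.\<close>

lemma act_commutator:
  assumes "f \<in> polys n"
  shows "act (E i) (act (F i) f) - act (F i) (act (E i) f)
    = der (\<lambda>S. pm_scale (if i \<in> S then - 1 else 1) (Var S)) f"
  using assms
proof (rule derivation_unique)
  have [simp]: "{j. (j = i \<or> j \<in> S) \<and> j < i} = {j \<in> S. j < i}"
    "{j. j \<in> S \<and> j \<noteq> i \<and> j < i} = {j \<in> S. j < i}" for S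
    by auto
  show "act (E i) (act (F i) (Var S)) - act (F i) (act (E i) (Var S))
      = pm_scale (if i \<in> S then - 1 else 1) (Var S)" for S
    by (simp add: der_scale insert_absorb flip: power_mult_distrib)
qed (simp_all add: der_add der_scale der_mult algebra_simps pm.scale_right_diff_distrib)

section \<open>Eigenvalues of the Casimir operator\<close>

definition flip :: "nat \<Rightarrow> nat set \<Rightarrow> nat set" where
  "flip i S = (if i \<in> S then S - {i} else insert i S)"

definition pair_mon :: "nat set \<Rightarrow> nat set \<Rightarrow> monom" where
  "pair_mon S T = single S 1 + single T 1"

lemma Var_mult_Var: "Var S * Var T = single (pair_mon S T) 1"
  by (simp add: Var_def pair_mon_def mult_single)

lemma card_add_eq_sym_diff:
  assumes "finite A" "finite B"
  shows "card A + card B = card (sym_diff A B) + 2 * card (A \<inter> B)"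
proof -
  have "card (sym_diff A B) = card (A - B) + card (B - A)"
    using assms by (intro card_Un_disjoint) auto
  moreover have "card A = card (A - B) + card (A \<inter> B)" "card B = card (B - A) + card (A \<inter> B)"
    using assms card_Int_Diff[of A B] card_Int_Diff[of B A] by (simp_all add: Int_commute)
  ultimately show ?thesis by simp
qed

lemma sign_sym_diff:
  assumes "finite A" "finite B"
  shows "(-1) ^ card A * (-1) ^ card B = ((-1) ^ card (sym_diff A B) :: 'a::comm_ring_1)"
  using card_add_eq_sym_diff[OF assms] by (simp add: power_mult flip: power_add) (simp add: power_add power_mult)

text \<open>\<open>E i\<close> needs \<open>i\<close> in its index set and \<open>F i\<close> needs
  it outside. So only \<open>i\<close> in the symmetric difference contributes, through one of the
  two products, which flips \<open>i\<close> on both sides. The two signs multiply to one that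
  depends on the symmetric difference alone.\<close>

lemma quadric_expand:
  assumes "S \<subseteq> {1..n}" "T \<subseteq> {1..n}"
  shows "quadric n S T =
    (\<Sum>i\<in>sym_diff S T. single (pair_mon (flip i S) (flip i T)) (2 * (-1) ^ card {j\<in>sym_diff S T. j < i}))
    + single (pair_mon S T) ((-1) ^ card (sym_diff S T) - 1)"
proof -
  let ?D = "sym_diff S T"
  let ?s = "\<lambda>i. (-1 :: complex) ^ card {j\<in>?D. j < i}"
  have fin: "finite S" "finite T"
    using assms finite_subset by blast+
  have sign: "(-1) ^ card {j\<in>S. j < i} * (-1) ^ card {j\<in>T. j < i} = ?s i" for i
  proof -
    have "sym_diff {j\<in>S. j < i} {j\<in>T. j < i} = {j\<in>?D. j < i}" by auto
    then show ?thesis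
      using sign_sym_diff[of "{j\<in>S. j < i}" "{j\<in>T. j < i}", where 'a = complex] fin by simp
  qed
  have "act (E i) (Var S) * act (F i) (Var T) + act (F i) (Var S) * act (E i) (Var T)
      = (if i \<in> ?D then pm_scale (?s i) (Var (flip i S) * Var (flip i T)) else 0)" for i
    using sign[of i] by (auto simp: flip_def pm_scale_mult_left pm_scale_mult_right mult.commute)
  then have "(\<Sum>i\<in>{1..n}. act (E i) (Var S) * act (F i) (Var T) + act (F i) (Var S) * act (E i) (Var T))
      = (\<Sum>i\<in>{1..n}. if i \<in> ?D then pm_scale (?s i) (Var (flip i S) * Var (flip i T)) else 0)"
    by simp
  also have "\<dots> = (\<Sum>i\<in>?D. pm_scale (?s i) (Var (flip i S) * Var (flip i T)))"
    using assms by (subst sum.inter_restrict[symmetric]) (auto intro!: sum.cong)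
  finally have sum: "pm_scale 2 (\<Sum>i\<in>{1..n}. act (E i) (Var S) * act (F i) (Var T) + act (F i) (Var S) * act (E i) (Var T))
      = (\<Sum>i\<in>?D. single (pair_mon (flip i S) (flip i T)) (2 * ?s i))"
    by (simp add: Var_mult_Var pm.scale_sum_right)
  have rest: "act E0 (Var S) * act E0 (Var T) - euler (Var S) * euler (Var T)
      = single (pair_mon S T) ((-1) ^ card (sym_diff S T) - 1)"
    using sign_sym_diff[OF fin, where 'a = complex]
    by (simp add: pm_scale_mult_left pm_scale_mult_right Var_mult_Var single_diff mult.commute)
  show ?thesis
    unfolding casimir_form_def sum add_diff_eq[symmetric] rest ..
qed

lemma keys_quadricE:
  assumes "m \<in> keys (quadric n S T)" "S \<subseteq> {1..n}" "T \<subseteq> {1..n}"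
  obtains i where "i \<in> sym_diff S T" "m = pair_mon (flip i S) (flip i T)"
  | "odd (card (sym_diff S T))" "m = pair_mon S T"
proof -
  let ?c = "(-1) ^ card (sym_diff S T) - 1 :: complex"
  have "m \<in> keys (\<Sum>i\<in>sym_diff S T. single (pair_mon (flip i S) (flip i T))
      (2 * (-1 :: complex) ^ card {j\<in>sym_diff S T. j < i})) \<union> keys (single (pair_mon S T) ?c)"
    using assms(1) unfolding quadric_expand[OF assms(2,3)] by (rule subsetD[OF keys_add])
  then show ?thesis
  proof (rule UnE)
    assume "m \<in> keys (\<Sum>i\<in>sym_diff S T. single (pair_mon (flip i S) (flip i T))
      (2 * (-1 :: complex) ^ card {j\<in>sym_diff S T. j < i}))"
    from subsetD[OF keys_sum this] show ?thesis
      using that(1) by auto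
  next
    assume "m \<in> keys (single (pair_mon S T) ?c)"
    then show ?thesis
      using that(2) by (cases "even (card (sym_diff S T))") auto
  qed
qed

section \<open>Gradings of monomials and eigenvalues\<close>

text \<open>Eigenvalue on a monomial of the diagonal derivation that multiplies each
  \<open>Var S\<close> by \<open>w S\<close>.\<close>

definition stat :: "(nat set \<Rightarrow> int) \<Rightarrow> monom \<Rightarrow> int" where
  "stat w m = (\<Sum>S\<in>keys m. int (lookup m S) * w S)"

lemma stat_superset: "finite A \<Longrightarrow> keys m \<subseteq> A \<Longrightarrow> stat w m = (\<Sum>S\<in>A. int (lookup m S) * w S)"
  unfolding stat_def by (intro sum.mono_neutral_left) (auto simp: in_keys_iff)

lemma stat_add: "stat w (m + m') = stat w m + stat w m'"
proof -
  have "keys (m + m') \<subseteq> keys m \<union> keys m'"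
    by (rule keys_add)
  then show ?thesis
    by (simp add: stat_superset[of "keys m \<union> keys m'"] lookup_add algebra_simps sum.distrib)
qed

lemma stat_single [simp]: "stat w (single S k) = int k * w S"
  by (cases "k = 0") (simp_all add: stat_def)

lemma stat_pair_mon [simp]: "stat w (pair_mon S T) = w S + w T"
  by (simp add: pair_mon_def stat_add)

abbreviation wt :: "monom \<Rightarrow> int" where
  "wt \<equiv> stat (\<lambda>S. int (card S))"

text \<open>
  The eigenvalue of \<open>casimir\<close> on a monomial, up to terms in the images of the \<open>act (F i) \<circ> act (E i)\<close>.
\<close>

definition eigenvalue :: "monom \<Rightarrow> int" where
  "eigenvalue m = (stat (\<lambda>S. (-1) ^ card S) m)\<^sup>2 - (stat (\<lambda>S. 1) m)\<^sup>2 - 4 * wt m"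

lemma monom_degree_stat: "int (monom_degree m) = stat (\<lambda>S. 1) m"
  by (simp add: monom_degree_def stat_def)

lemma card_flip:
  "finite S \<Longrightarrow> int (card (flip i S)) = int (card S) + (if i \<in> S then - 1 else 1)"
  using card.remove[of S i] by (auto simp: flip_def)

lemma sign_flip: "finite S \<Longrightarrow> (-1 :: int) ^ card (flip i S) = - ((-1) ^ card S)"
  using card.remove[of S i] by (auto simp: flip_def simp del: card_Diff_singleton card_Diff_insert)

text \<open>Flipping \<open>i\<close> in two sets that differ at \<open>i\<close> keeps their total
  size and reverses both signs. The unflipped monomial occurs only for an odd symmetric difference,
  where the two signs cancel anyway. Hence \<open>eigenvalue\<close> is constant on the monomials of
  a quadric.\<close>

lemma quadric_stats:
  assumes "m \<in> keys (quadric n S T)" "S \<subseteq> {1..n}" "T \<subseteq> {1..n}"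
  shows "wt m = int (card S) + int (card T)" "stat (\<lambda>S. 1) m = 2"
    "stat (\<lambda>S. (-1) ^ card S) m = - ((-1) ^ card S + (-1) ^ card T)"
proof -
  have fin: "finite S" "finite T"
    using assms finite_subset by blast+
  show "wt m = int (card S) + int (card T)"
    using assms by (rule keys_quadricE) (auto simp: card_flip fin)
  show "stat (\<lambda>S. 1) m = 2"
    using assms by (rule keys_quadricE) auto
  show "stat (\<lambda>S. (-1) ^ card S) m = - ((-1) ^ card S + (-1) ^ card T)"
    using assms
  proof (cases rule: keys_quadricE)
    case 2
    have "(-1 :: int) ^ card S * (-1) ^ card T = - 1"
      using sign_sym_diff[OF fin, where 'a = int] 2 by simp
    moreover have "(-1 :: int) ^ card S = 1 \<or> (-1 :: int) ^ card S = - 1"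
      "(-1 :: int) ^ card T = 1 \<or> (-1 :: int) ^ card T = - 1"
      by (metis minus_one_power_iff)+
    ultimately show ?thesis
      using 2 by auto
  qed (auto simp: sign_flip fin)
qed

text \<open>The signed degree is at most the degree in absolute value, so the difference of squares
  and \<open>- 4 * wt m\<close> are both at most 0. If they sum to 0, the total size of the index
  sets is 0.\<close>

lemma eigenvalue_eq_0:
  assumes "eigenvalue m = 0" "keys m \<subseteq> Pow {1..n}"
  shows "keys m \<subseteq> {{}}"
proof -
  have "\<bar>stat (\<lambda>S. (-1) ^ card S) m\<bar> \<le> stat (\<lambda>S. 1) m"
    unfolding stat_def by (rule order_trans[OF sum_abs]) (simp add: abs_mult power_abs)
  then have "(stat (\<lambda>S. (-1) ^ card S) m)\<^sup>2 \<le> (stat (\<lambda>S. 1) m)\<^sup>2"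
    by (simp add: abs_le_square_iff[symmetric])
  moreover have "wt m \<ge> 0"
    unfolding stat_def by (intro sum_nonneg) simp
  ultimately have "wt m = 0"
    using assms(1) by (simp add: eigenvalue_def)
  then have "\<forall>S\<in>keys m. int (lookup m S) * int (card S) = 0"
    unfolding stat_def by (subst (asm) sum_nonneg_eq_0_iff) auto
  then have card: "\<forall>S\<in>keys m. card S = 0"
    by (auto simp: in_keys_iff)
  have "S = {}" if "S \<in> keys m" for S
  proof -
    have "finite S"
      using that assms(2) by (intro finite_subset[of S "{1..n}"]) auto
    then show ?thesis
      using card that by (auto simp: card_eq_0_iff)
  qed
  then show ?thesis by blast
qed

lemma lookup_der_diagonal:
  "lookup (der (\<lambda>S. pm_scale (of_int (w S)) (Var S)) f) m = of_int (stat w m) * lookup f m"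
proof (induction f rule: poly_mapping_add_induct)
  case (single m' c)
  show ?case
    by (simp add: der_diagonal_single stat_def lookup_single when_def)
qed (simp_all add: der_add lookup_add algebra_simps)

lemma lookup_euler: "lookup (euler f) m = of_int (stat (\<lambda>S. 1) m) * lookup f m"
  using lookup_der_diagonal[of "\<lambda>S. 1" f m] by simp

lemma lookup_act_E0: "lookup (act E0 f) m = of_int (stat (\<lambda>S. (-1) ^ card S) m) * lookup f m"
proof -
  have "coord_act E0 = (\<lambda>S. pm_scale (of_int ((-1) ^ card S)) (Var S))"
    by (simp add: fun_eq_iff)
  then show ?thesis
    using lookup_der_diagonal[of "\<lambda>S. (-1) ^ card S" f m] by simp
qed

lemma sum_signs:
  assumes "S \<subseteq> {1..n}"
  shows "(\<Sum>i\<in>{1..n}. if i \<in> S then - 1 else 1) = int n - 2 * int (card S)"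
proof -
  have "(\<Sum>i\<in>{1..n}. if i \<in> S then - 1 else 1 :: int) = (\<Sum>i\<in>{1..n}. 1 - 2 * (if i \<in> S then 1 else 0))"
    by (intro sum.cong) auto
  also have "\<dots> = int n - 2 * (\<Sum>i\<in>{1..n}. if i \<in> S then 1 else 0)"
    by (simp add: sum_subtractf sum_distrib_left)
  also have "(\<Sum>i\<in>{1..n}. if i \<in> S then 1 else 0) = (\<Sum>i\<in>{1..n} \<inter> S. 1 :: int)"
    by (subst sum.inter_restrict) simp_all
  also have "{1..n} \<inter> S = S"
    using assms by auto
  finally show ?thesis by simp
qed

lemma sum_stat_signs:
  assumes "keys m \<subseteq> Pow {1..n}"
  shows "(\<Sum>i\<in>{1..n}. stat (\<lambda>S. if i \<in> S then - 1 else 1) m) = int n * stat (\<lambda>S. 1) m - 2 * wt m"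
proof -
  have "(\<Sum>i\<in>{1..n}. stat (\<lambda>S. if i \<in> S then - 1 else 1) m)
      = (\<Sum>S\<in>keys m. int (lookup m S) * (\<Sum>i\<in>{1..n}. if i \<in> S then - 1 else 1))"
    unfolding stat_def by (subst sum.swap) (simp add: sum_distrib_left)
  also have "\<dots> = (\<Sum>S\<in>keys m. int (lookup m S) * (int n - 2 * int (card S)))"
    using assms by (intro sum.cong refl arg_cong2[of _ _ _ _ "(*)"] sum_signs) auto
  finally show ?thesis
    by (simp add: stat_def algebra_simps sum_subtractf sum_distrib_left)
qed

lemma lookup_casimir_diagonal:
  assumes f: "f \<in> polys n"
  shows "lookup (casimir n f - pm_scale 4 (\<Sum>i\<in>{1..n}. act (F i) (act (E i) f))) m
    = of_int (eigenvalue m) * lookup f m"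
proof (cases "m \<in> keys f")
  case True
  then have m: "keys m \<subseteq> Pow {1..n}"
    using f by (auto simp: polys_iff)
  have "lookup (act (E i) (act (F i) f)) m
      = of_int (stat (\<lambda>S. if i \<in> S then - 1 else 1) m) * lookup f m + lookup (act (F i) (act (E i) f)) m"
    for i
  proof -
    have eq: "(\<lambda>S. pm_scale (if i \<in> S then - 1 else 1) (Var S))
        = (\<lambda>S. pm_scale (of_int (if i \<in> S then - 1 else 1)) (Var S))"
      by (simp add: fun_eq_iff)
    show ?thesis
      using arg_cong[OF act_commutator[OF f, of i], of "\<lambda>p. lookup p m"]
      unfolding eq lookup_der_diagonal by (simp add: lookup_minus algebra_simps)
  qed
  \<comment> \<open>Twice (E F + F E) minus four times F E is twice the commutator, which is
    diagonal.\<close>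
  then have "lookup (casimir n f - pm_scale 4 (\<Sum>i\<in>{1..n}. act (F i) (act (E i) f))) m
      = 2 * of_int (\<Sum>i\<in>{1..n}. stat (\<lambda>S. if i \<in> S then - 1 else 1) m) * lookup f m
      + of_int ((stat (\<lambda>S. (-1) ^ card S) m)\<^sup>2) * lookup f m
      - 2 * of_nat n * of_int (stat (\<lambda>S. 1) m) * lookup f m
      - of_int ((stat (\<lambda>S. 1) m)\<^sup>2) * lookup f m"
    by (simp add: casimir_def lookup_minus lookup_add lookup_sum lookup_euler lookup_act_E0
        sum.distrib sum_distrib_left sum_distrib_right power2_eq_square algebra_simps del: coord_act.simps)
  also have "\<dots> = of_int (eigenvalue m) * lookup f m"
    unfolding sum_stat_signs[OF m] by (simp add: eigenvalue_def algebra_simps)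
  finally show ?thesis .
next
  \<comment> \<open>Here \<open>m\<close> may involve indices outside \<open>{1..n}\<close>, beyond
    the reach of \<open>sum_stat_signs\<close>; but every diagonal term carries the factor
    \<open>lookup f m\<close>, which is 0.\<close>
  case False
  then have zero: "lookup f m = 0"
    by (simp add: in_keys_iff)
  have "lookup (act (E i) (act (F i) f)) m = lookup (act (F i) (act (E i) f)) m" for i
  proof -
    have eq: "(\<lambda>S. pm_scale (if i \<in> S then - 1 else 1) (Var S))
        = (\<lambda>S. pm_scale (of_int (if i \<in> S then - 1 else 1)) (Var S))"
      by (simp add: fun_eq_iff)
    show ?thesis
      using arg_cong[OF act_commutator[OF f, of i], of "\<lambda>p. lookup p m"]
      unfolding eq lookup_der_diagonal by (simp add: lookup_minus zero)
  qed
  then show ?thesis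
    by (simp add: casimir_def lookup_minus lookup_add lookup_sum lookup_euler lookup_act_E0 zero
        sum.distrib del: coord_act.simps)
qed

section \<open>Projections onto sets of monomials\<close>

definition restrict_keys :: "('k \<Rightarrow> bool) \<Rightarrow> ('k \<Rightarrow>\<^sub>0 complex) \<Rightarrow> ('k \<Rightarrow>\<^sub>0 complex)" where
  "restrict_keys P f = (\<Sum>m\<in>{m\<in>keys f. P m}. single m (lookup f m))"

lemma lookup_restrict_keys: "lookup (restrict_keys P f) m = (if P m then lookup f m else 0)"
  by (simp add: restrict_keys_def lookup_sum lookup_single when_def in_keys_iff)

lemma keys_restrict_keys: "keys (restrict_keys P f) = {m \<in> keys f. P m}"
  by (auto simp: in_keys_iff lookup_restrict_keys split: if_splits)

lemma restrict_keys_id: "(\<And>m. m \<in> keys f \<Longrightarrow> P m) \<Longrightarrow> restrict_keys P f = f"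
  by (rule poly_mapping_eqI) (auto simp: lookup_restrict_keys in_keys_iff)

lemma restrict_keys_zero: "(\<And>m. m \<in> keys f \<Longrightarrow> \<not> P m) \<Longrightarrow> restrict_keys P f = 0"
  by (rule poly_mapping_eqI) (auto simp: lookup_restrict_keys in_keys_iff)

lemma restrict_keys_span:
  assumes "x \<in> pm.span G" "pm.subspace V" "\<And>b. b \<in> G \<Longrightarrow> restrict_keys P b \<in> V"
  shows "restrict_keys P x \<in> V"
  using assms(1)
proof (induction rule: pm.span_induct_alt)
  case base
  then show ?case
    using pm.subspace_0[OF assms(2)] by (simp add: restrict_keys_def)
next
  case (step c b y)
  have "restrict_keys P (pm_scale c b + y) = pm_scale c (restrict_keys P b) + restrict_keys P y"
    by (rule poly_mapping_eqI) (simp add: lookup_restrict_keys lookup_add)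
  then show ?case
    using step assms by (simp add: pm.subspace_add pm.subspace_scale)
qed

lemma keys_single_mult:
  assumes "x \<in> keys (single m 1 * (f :: poly))"
  obtains y where "y \<in> keys f" "x = m + y"
  using assms keys_mult[of "single m 1" f] by (auto split: if_splits)

text \<open>All monomials of a spanning element have the same eigenvalue, so the projection keeps or
  kills the element.\<close>

lemma quadric_ideal_restrict_eigenvalue:
  assumes "q \<in> quadric_ideal n"
  shows "restrict_keys (\<lambda>m. eigenvalue m = l) q \<in> quadric_ideal n"
proof (rule restrict_keys_span[OF _ subspace_quadric_ideal])
  show "q \<in> pm.span {single m 1 * quadric n S T | m S T.
      keys m \<subseteq> Pow {1..n} \<and> S \<subseteq> {1..n} \<and> T \<subseteq> {1..n}}"
    using assms by (simp only: quadric_ideal_def)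
next
  fix b assume b: "b \<in> {single m 1 * quadric n S T | m S T.
      keys m \<subseteq> Pow {1..n} \<and> S \<subseteq> {1..n} \<and> T \<subseteq> {1..n}}"
  then obtain m S T where bm: "b = single m 1 * quadric n S T" and ST: "S \<subseteq> {1..n}" "T \<subseteq> {1..n}"
    by blast
  have "b \<in> quadric_ideal n"
    unfolding quadric_ideal_def using b by (rule pm.span_base)
  have "eigenvalue x = (stat (\<lambda>S. (-1) ^ card S) m - ((-1) ^ card S + (-1) ^ card T))\<^sup>2
      - (stat (\<lambda>S. 1) m + 2)\<^sup>2 - 4 * (wt m + (int (card S) + int (card T)))" if "x \<in> keys b" for x
    using that unfolding bm
    by (elim keys_single_mult) (simp add: eigenvalue_def stat_add quadric_stats[OF _ ST] algebra_simps)
  then have "restrict_keys (\<lambda>m. eigenvalue m = l) b = b \<or> restrict_keys (\<lambda>m. eigenvalue m = l) b = 0"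
    using restrict_keys_id[of b "\<lambda>m. eigenvalue m = l"] restrict_keys_zero[of b "\<lambda>m. eigenvalue m = l"]
    by metis
  then show "restrict_keys (\<lambda>m. eigenvalue m = l) b \<in> quadric_ideal n"
    using \<open>b \<in> quadric_ideal n\<close> pm.subspace_0[OF subspace_quadric_ideal] by auto
qed

text \<open>The polynomial \<open>d\<close> lies in the quadric ideal and arises from
  \<open>f\<close> by a diagonal operator, so the component of \<open>f\<close> for an eigenvalue
  \<open>l \<noteq> 0\<close> is that of \<open>d\<close> divided by \<open>l\<close>. Eigenvalue 0
  is left to the powers of the variable of the empty set.\<close>

lemma quadric_ideal_eigencomponents:
  assumes f: "f \<in> polys n" and E: "\<And>i. i \<in> {1..n} \<Longrightarrow> act (E i) f \<in> quadric_ideal n"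
  shows "f - restrict_keys (\<lambda>m. keys m \<subseteq> {{}}) f \<in> quadric_ideal n"
proof -
  let ?p = "\<lambda>l. restrict_keys (\<lambda>m. eigenvalue m = l)"
  define d where "d = casimir n f - pm_scale 4 (\<Sum>i\<in>{1..n}. act (F i) (act (E i) f))"
  have d: "d \<in> quadric_ideal n"
    unfolding d_def using E
    by (intro pm.subspace_diff pm.subspace_scale pm.subspace_sum subspace_quadric_ideal
        casimir_in_quadric_ideal f act_F_quadric_ideal) auto
  have part: "?p l f \<in> quadric_ideal n" if "l \<noteq> 0" for l
  proof -
    have "?p l f = pm_scale (1 / of_int l) (?p l d)"
      using that by (intro poly_mapping_eqI)
        (simp add: lookup_restrict_keys d_def lookup_casimir_diagonal[OF f] del: One_nat_def)
    then show ?thesis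
      using quadric_ideal_restrict_eigenvalue[OF d, of l]
      by (simp add: pm.subspace_scale[OF subspace_quadric_ideal])
  qed
  have zero: "eigenvalue m = 0 \<longleftrightarrow> keys m \<subseteq> {{}}" if "m \<in> keys f" for m
  proof
    assume *: "keys m \<subseteq> {{}}"
    then show "eigenvalue m = 0"
      by (simp add: eigenvalue_def stat_superset[OF _ *])
  next
    assume "eigenvalue m = 0"
    then show "keys m \<subseteq> {{}}"
      by (rule eigenvalue_eq_0) (use f that in \<open>auto simp: polys_iff\<close>)
  qed
  have "f - restrict_keys (\<lambda>m. keys m \<subseteq> {{}}) f = (\<Sum>l\<in>eigenvalue ` keys f - {0}. ?p l f)"
  proof (rule poly_mapping_eqI)
    fix m
    show "lookup (f - restrict_keys (\<lambda>m. keys m \<subseteq> {{}}) f) m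
        = lookup (\<Sum>l\<in>eigenvalue ` keys f - {0}. ?p l f) m"
    proof (cases "m \<in> keys f")
      case True
      have "lookup (\<Sum>l\<in>eigenvalue ` keys f - {0}. ?p l f) m
          = (\<Sum>l\<in>eigenvalue ` keys f - {0}. if l = eigenvalue m then lookup f m else 0)"
        unfolding lookup_sum lookup_restrict_keys by (intro sum.cong) auto
      also have "\<dots> = (if eigenvalue m = 0 then 0 else lookup f m)"
        using True by (simp add: sum.delta)
      finally show ?thesis
        using zero[OF True] by (simp add: lookup_minus lookup_restrict_keys)
    next
      case False
      then show ?thesis
        by (simp add: lookup_minus lookup_sum lookup_restrict_keys in_keys_iff)
    qed
  qed
  also have "\<dots> \<in> quadric_ideal n"
    using part by (intro pm.subspace_sum subspace_quadric_ideal) auto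
  finally show ?thesis .
qed

text \<open>\<open>E i\<close> replaces one index set containing \<open>i\<close> by the same set
  without \<open>i\<close>.\<close>

lemma wt_act_E_less:
  assumes f: "f \<in> polys n" and m: "m \<in> keys (act (E i) f)"
  obtains m' where "m' \<in> keys f" "wt m < wt m'"
proof -
  have "m \<in> (\<Union>m'\<in>keys f. keys (pm_scale (lookup f m') (der_mon (coord_act (E i)) m')))"
    using m unfolding der_def by (rule subsetD[OF keys_sum])
  then obtain m' where m': "m' \<in> keys f" "m \<in> keys (pm_scale (lookup f m') (der_mon (coord_act (E i)) m'))"
    by (rule UN_E)
  from m'(2) have "m \<in> keys (der_mon (coord_act (E i)) m')"
    by (rule subsetD[OF keys_pm_scale_subset])
  then have "m \<in> (\<Union>S\<in>keys m'. keys (pm_scale (of_nat (lookup m' S)) (single (m' - single S 1) 1 * coord_act (E i) S)))"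
    unfolding der_mon_def by (rule subsetD[OF keys_sum])
  then obtain S where S: "S \<in> keys m'"
      "m \<in> keys (pm_scale (of_nat (lookup m' S)) (single (m' - single S 1) 1 * coord_act (E i) S))"
    by (rule UN_E)
  from S(2) have S2: "m \<in> keys (single (m' - single S 1) 1 * coord_act (E i) S)"
    by (rule subsetD[OF keys_pm_scale_subset])
  from S2 have i: "i \<in> S"
    by (auto split: if_splits)
  with S2 have m_eq: "m = m' - single S 1 + single (S - {i}) 1"
    by (auto simp: Var_def mult_single split: if_splits)
  have m'_eq: "m' = m' - single S 1 + single S 1"
    using S(1) by (intro poly_mapping_eqI)
      (auto simp: lookup_add lookup_minus lookup_single when_def in_keys_iff)
  have "finite S"
    using f m'(1) S(1) finite_subset[of S "{1..n}"] by (auto simp: polys_iff)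
  then have "card (S - {i}) < card S"
    using i by (rule card_Diff1_less)
  then have "wt m < wt m'"
    unfolding m_eq by (subst (2) m'_eq) (simp add: stat_add)
  with m'(1) show ?thesis
    by (rule that)
qed

section \<open>Pure spinors\<close>

lemma clifford_act_add_left: "clifford_act n (v + w) s = clifford_act n v s + clifford_act n w s"
  by (simp add: clifford_act_def lookup_add pm.scale_left_distrib sum.distrib)

lemma clifford_act_scale_left: "clifford_act n (pm_scale c v) s = pm_scale c (clifford_act n v s)"
  by (simp add: clifford_act_def pm.scale_sum_right)

lemma clifford_act_0_left [simp]: "clifford_act n 0 s = 0"
  by (simp add: clifford_act_def)

lemma clifford_act_diff_left: "clifford_act n (v - w) s = clifford_act n v s - clifford_act n w s"
  using clifford_act_add_left[of n "v - w" w s] by simp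

lemma clifford_act_add: "clifford_act n v (s + t) = clifford_act n v s + clifford_act n v t"
  by (simp add: clifford_act_def gen_act_add pm.scale_right_distrib sum.distrib)

lemma clifford_act_scale: "clifford_act n v (pm_scale c s) = pm_scale c (clifford_act n v s)"
  by (simp add: clifford_act_def gen_act_scale pm.scale_sum_right mult.commute)

lemma clifford_act_diff: "clifford_act n v (s - t) = clifford_act n v s - clifford_act n v t"
  using clifford_act_add[of n v "s - t" t] by simp

lemma clifford_act_single:
  "g \<in> qbasis_set n \<Longrightarrow> clifford_act n (single g c) s = pm_scale c (gen_act g s)"
proof -
  assume g: "g \<in> qbasis_set n"
  have "clifford_act n (single g c) s = (\<Sum>h\<in>qbasis_set n. if h = g then pm_scale c (gen_act g s) else 0)"
    unfolding clifford_act_def by (intro sum.cong) (auto simp: lookup_single when_def)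
  then show ?thesis
    using g by simp
qed

lemma subspace_spinor_space: "pm.subspace (spinor_space n)"
proof (rule pm.subspaceI)
  show "x + y \<in> spinor_space n" if "x \<in> spinor_space n" "y \<in> spinor_space n" for x y
    using that keys_add[of x y] unfolding spinor_space_def by blast
  show "pm_scale c x \<in> spinor_space n" if "x \<in> spinor_space n" for c x
    using that keys_pm_scale_subset[of c x] unfolding spinor_space_def by blast
qed (simp add: spinor_space_def)

section \<open>Polarizations and annihilators\<close>

text \<open>
  A subset \<open>U\<close> determines the polarization in which \<open>single U 1\<close> is the vacuum: \<open>down_gen U i\<close>
  annihilates it and \<open>up_gen U i\<close> does not.
\<close>

definition up_gen :: "nat set \<Rightarrow> nat \<Rightarrow> qbasis" where
  "up_gen U i = (if i \<in> U then F i else E i)"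

definition down_gen :: "nat set \<Rightarrow> nat \<Rightarrow> qbasis" where
  "down_gen U i = (if i \<in> U then E i else F i)"

lemma up_down_gen_simps [simp]:
  "up_gen U i = up_gen U j \<longleftrightarrow> i = j" "down_gen U i = down_gen U j \<longleftrightarrow> i = j"
  "up_gen U i \<noteq> down_gen U j" "down_gen U j \<noteq> up_gen U i"
  "up_gen U i \<noteq> E0" "down_gen U i \<noteq> E0" "E0 \<noteq> up_gen U i" "E0 \<noteq> down_gen U i"
  by (auto simp: up_gen_def down_gen_def)

lemma up_down_gen_memb [simp]:
  "up_gen U i \<in> qbasis_set n \<longleftrightarrow> i \<in> {1..n}" "down_gen U i \<in> qbasis_set n \<longleftrightarrow> i \<in> {1..n}"
  by (auto simp: up_gen_def down_gen_def)

lemma qbasis_set_up_down: "qbasis_set n = up_gen U ` {1..n} \<union> down_gen U ` {1..n} \<union> {E0}"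
  by (auto simp: qbasis_set_def up_gen_def down_gen_def image_iff)

abbreviation flip_sign :: "nat \<Rightarrow> nat set \<Rightarrow> complex" where
  "flip_sign i S \<equiv> (-1) ^ card {j\<in>S. j < i}"

lemma lookup_up_gen:
  "lookup (gen_act (up_gen U i) s) S = (if i \<in> sym_diff S U then flip_sign i S * lookup s (flip i S) else 0)"
  by (auto simp: poly_eval_coord_act[symmetric] up_gen_def flip_def)

lemma lookup_down_gen:
  "lookup (gen_act (down_gen U i) s) S = (if i \<in> sym_diff S U then 0 else flip_sign i S * lookup s (flip i S))"
  by (auto simp: poly_eval_coord_act[symmetric] down_gen_def flip_def)

lemma lookup_gen_act_E0: "lookup (gen_act E0 s) S = (-1) ^ card S * lookup s S"
  by (simp flip: poly_eval_coord_act)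

lemma gen_act_spinor:
  assumes g: "g \<in> qbasis_set n" and s: "s \<in> spinor_space n"
  shows "gen_act g s \<in> spinor_space n"
proof -
  have "S \<subseteq> {1..n}" if S: "lookup (gen_act g s) S \<noteq> 0" for S
  proof -
    have T: "T \<subseteq> {1..n}" if "lookup s T \<noteq> 0" for T
      using s that by (auto simp: spinor_space_def in_keys_iff)
    show ?thesis
    proof (cases g)
      case (E i)
      then show ?thesis
        using S g T[of "S - {i}"] by (auto simp flip: poly_eval_coord_act split: if_splits)
    next
      case (F i)
      then show ?thesis
        using S T[of "insert i S"] by (auto simp flip: poly_eval_coord_act split: if_splits)
    next
      case E0
      then show ?thesis
        using S T[of S] by (simp flip: poly_eval_coord_act)
    qed
  qed
  then show ?thesis
    by (auto simp: spinor_space_def in_keys_iff)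
qed

lemma clifford_act_spinor: "s \<in> spinor_space n \<Longrightarrow> clifford_act n v s \<in> spinor_space n"
  unfolding clifford_act_def
  by (intro pm.subspace_sum pm.subspace_scale subspace_spinor_space gen_act_spinor)

lemma sum_up_down:
  fixes h :: "qbasis \<Rightarrow> 'a :: ab_group_add"
  shows "(\<Sum>g\<in>qbasis_set n. h g) = (\<Sum>i\<in>{1..n}. h (up_gen U i)) + (\<Sum>i\<in>{1..n}. h (down_gen U i)) + h E0"
proof -
  have "h (E i) + h (F i) = h (up_gen U i) + h (down_gen U i)" for i
    by (simp add: up_gen_def down_gen_def add.commute)
  then show ?thesis
    by (simp add: sum_qbasis_set flip: sum.distrib)
qed

lemma qform_up_down:
  "qform n v = (\<Sum>i\<in>{1..n}. lookup v (up_gen U i) * lookup v (down_gen U i)) + (lookup v E0)\<^sup>2"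
  unfolding qform_def
  by (intro arg_cong2[of _ _ _ _ "(+)"] sum.cong refl) (simp_all add: up_gen_def down_gen_def mult.commute)

lemma lookup_clifford_act:
  "lookup (clifford_act n v s) S =
     (\<Sum>i\<in>{1..n}. lookup v (up_gen U i) * lookup (gen_act (up_gen U i) s) S)
   + (\<Sum>i\<in>{1..n}. lookup v (down_gen U i) * lookup (gen_act (down_gen U i) s) S)
   + lookup v E0 * lookup (gen_act E0 s) S"
  unfolding clifford_act_def lookup_sum by (simp add: sum_up_down[of _ n U])

lemma flip_flip [simp]: "flip i (flip i S) = S"
  by (auto simp: flip_def)

lemma sym_diff_flip: "sym_diff (flip i S) U = flip i (sym_diff S U)"
  by (auto simp: flip_def)

text \<open>\<open>flip i U\<close> differs from \<open>U\<close> at \<open>i\<close> only, so among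
  the \<open>up_gen\<close> only \<open>up_gen U i\<close> contributes there. This recovers the
  \<open>up_gen\<close> coefficients of a vector that annihilates a spinor nonzero at
  \<open>U\<close>.\<close>

lemma lookup_clifford_act_neighbour:
  assumes "i \<in> {1..n}" "\<And>j. j \<in> {1..n} \<Longrightarrow> lookup v (down_gen U j) = 0" "lookup v E0 = 0"
  shows "lookup (clifford_act n v s) (flip i U) = lookup v (up_gen U i) * flip_sign i (flip i U) * lookup s U"
proof -
  have "sym_diff (flip i U) U = {i}"
    by (auto simp: flip_def)
  then have "(\<Sum>j\<in>{1..n}. lookup v (up_gen U j) * lookup (gen_act (up_gen U j) s) (flip i U))
      = (\<Sum>j\<in>{1..n}. if j = i then lookup v (up_gen U i) * (flip_sign i (flip i U) * lookup s U) else 0)"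
    by (intro sum.cong refl) (auto simp: lookup_up_gen)
  then show ?thesis
    using assms by (simp add: lookup_clifford_act[of _ _ _ _ U])
qed

text \<open>
  A spinor \<open>s\<close> with \<open>lookup s U \<noteq> 0\<close> forces its annihilator to be the graph of a linear map over the
  span of the \<open>down_gen U i\<close>.
\<close>

lemma isotropic_graph_basis:
  assumes L: "L \<in> OGr n" and ann: "\<And>v. v \<in> L \<Longrightarrow> clifford_act n v s = 0" and s: "lookup s U \<noteq> 0"
  obtains v where "\<And>i. i \<in> {1..n} \<Longrightarrow> v i \<in> L"
    "\<And>i j. i \<in> {1..n} \<Longrightarrow> j \<in> {1..n} \<Longrightarrow> lookup (v i) (down_gen U j) = (if i = j then 1 else 0)"
proof -
  define \<pi> :: "(qbasis \<Rightarrow>\<^sub>0 complex) \<Rightarrow> (qbasis \<Rightarrow>\<^sub>0 complex)" where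
    "\<pi> = restrict_keys (\<lambda>g. g \<in> down_gen U ` {1..n})"
  have sub: "pm.subspace L" and dim: "pm.dim L = n" and Lq: "L \<subseteq> qspace n"
    using L by (auto simp: OGr_def)
  interpret \<pi>: Vector_Spaces.linear pm_scale pm_scale \<pi>
  proof -
    have "\<pi> (x + y) = \<pi> x + \<pi> y" "\<pi> (pm_scale c x) = pm_scale c (\<pi> x)" for c x y
      unfolding \<pi>_def by (rule poly_mapping_eqI, simp add: lookup_restrict_keys lookup_add)+
    then show "Vector_Spaces.linear pm_scale pm_scale \<pi>"
      unfolding Vector_Spaces.linear_iff using pm.vector_space_axioms by blast
  qed
  \<comment> \<open>Without a \<open>down_gen\<close> part, isotropy says that the square of the
    \<open>E0\<close> coefficient is 0. The coordinates of x s at the neighbours of \<open>U\<close>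
    are then, up to sign, the \<open>up_gen\<close> coefficients times
    \<open>lookup s U\<close>.\<close>
  have inj: "x = 0" if x: "x \<in> L" and \<pi>x: "\<pi> x = 0" for x
  proof -
    have down: "lookup x (down_gen U j) = 0" if "j \<in> {1..n}" for j
      using arg_cong[OF \<pi>x, of "\<lambda>p. lookup p (down_gen U j)"] that
      by (simp add: \<pi>_def lookup_restrict_keys)
    have "qform n x = 0"
      using L x by (simp add: OGr_def)
    then have E0: "lookup x E0 = 0"
      using down by (simp add: qform_up_down[of _ _ U])
    have up: "lookup x (up_gen U i) = 0" if "i \<in> {1..n}" for i
      using lookup_clifford_act_neighbour[OF that down E0, where s = s] ann[OF x] s by simp
    have "lookup x g = 0" for g
    proof (cases "g \<in> qbasis_set n")
      case True
      then show ?thesis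
        using up down E0 unfolding qbasis_set_up_down[of n U] by blast
    next
      case False
      then have "g \<notin> keys x"
        using Lq x by (auto simp: qspace_def)
      then show ?thesis
        by (simp add: in_keys_iff)
    qed
    then show ?thesis
      by (intro poly_mapping_eqI) simp
  qed
  obtain B where B: "B \<subseteq> L" "pm.independent B" "L \<subseteq> pm.span B" "card B = n"
    using pm.basis_exists[of L] dim by blast
  have spanB: "pm.span B = L"
    using B sub pm.span_minimal by blast
  have injB: "inj_on \<pi> L"
    using inj \<pi>.inj_on_iff_eq_0[OF sub] by blast
  have ind: "pm.independent (\<pi> ` B)"
    using B(2) injB by (intro \<pi>.independent_injective_image) (simp_all add: spanB)
  have card: "card (\<pi> ` B) = n"
    using injB B(1,4) by (simp add: card_image inj_on_subset)
  define D where "D = (\<lambda>i. single (down_gen U i) (1::complex)) ` {1..n}"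
  have D: "finite D" "card D \<le> n"
    unfolding D_def using card_image_le[of "{1..n}"] by auto
  have inD: "\<pi> x \<in> pm.span D" for x
  proof -
    have "\<pi> x = (\<Sum>g\<in>keys (\<pi> x). pm_scale (lookup (\<pi> x) g) (single g 1))"
      by (simp add: poly_mapping_sum_singles)
    also have "\<dots> \<in> pm.span D"
      by (intro pm.span_sum pm.span_scale pm.span_base)
        (auto simp: \<pi>_def keys_restrict_keys D_def)
    finally show ?thesis .
  qed
  \<comment> \<open>Surjectivity by counting: a missed vector would extend the \<open>n\<close>
    independent images of a basis of \<open>L\<close> to \<open>n + 1\<close> independent vectors in
    the span of at most \<open>n\<close>.\<close>
  have "\<exists>w\<in>L. \<pi> w = single (down_gen U i) 1" if i: "i \<in> {1..n}" for i
  proof (rule ccontr)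
    let ?t = "single (down_gen U i) (1::complex)"
    assume "\<not> ?thesis"
    then have t: "?t \<notin> pm.span (\<pi> ` B)"
      by (auto simp: \<pi>.span_image spanB)
    have "pm.independent (insert ?t (\<pi> ` B))"
      using ind t pm.independent_insertI by blast
    moreover have "insert ?t (\<pi> ` B) \<subseteq> pm.span D"
      using inD i by (auto simp: D_def intro: pm.span_base)
    ultimately have "finite (insert ?t (\<pi> ` B)) \<and> card (insert ?t (\<pi> ` B)) \<le> card D"
      by (rule pm.independent_span_bound[OF D(1)])
    moreover have "?t \<notin> \<pi> ` B"
      using t by (rule contrapos_nn) (rule pm.span_base)
    ultimately show False
      using card D(2) by auto
  qed
  then obtain v where v: "\<And>i. i \<in> {1..n} \<Longrightarrow> v i \<in> L \<and> \<pi> (v i) = single (down_gen U i) 1"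
    by metis
  show thesis
  proof (rule that[of v])
    fix i j assume ij: "i \<in> {1..n}" "j \<in> {1..n}"
    have "lookup (v i) (down_gen U j) = lookup (\<pi> (v i)) (down_gen U j)"
      using ij(2) by (simp add: \<pi>_def lookup_restrict_keys)
    then show "lookup (v i) (down_gen U j) = (if i = j then 1 else 0)"
      using v[OF ij(1)] by (simp add: lookup_single when_def)
  qed (use v in blast)
qed

text \<open>
  The relation \<open>v i \<cdot> s = 0\<close> expresses \<open>lookup s T\<close>, for \<open>i\<close> in which \<open>T\<close> and \<open>U\<close> differ, through
  coordinates closer to \<open>U\<close>.
\<close>

lemma spinor_eq_0_if_annihilated:
  assumes s: "s \<in> spinor_space n" and U: "U \<subseteq> {1..n}" and sU: "lookup s U = 0"
    and ann: "\<And>i. i \<in> {1..n} \<Longrightarrow> clifford_act n (v i) s = 0"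
    and v: "\<And>i j. i \<in> {1..n} \<Longrightarrow> j \<in> {1..n} \<Longrightarrow> lookup (v i) (down_gen U j) = (if i = j then 1 else 0)"
  shows "s = 0"
proof (rule poly_mapping_eqI)
  fix T
  have "lookup s T = 0" if "T \<subseteq> {1..n}"
    using that
  proof (induction "card (sym_diff T U)" arbitrary: T rule: less_induct)
    case less
    show ?case
    proof (cases "T = U")
      case False
      then obtain i where i: "i \<in> sym_diff T U" by blast
      then have i_le: "i \<in> {1..n}"
        using less.prems U by auto
      \<comment> \<open>The relation is read at \<open>?T\<close>, one step closer to
        \<open>U\<close>: the \<open>up_gen\<close> terms involve coordinates closer still, the
        \<open>E0\<close> term the one at \<open>?T\<close>, and the only surviving
        \<open>down_gen\<close> term the one at \<open>T\<close>.\<close>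
      let ?T = "flip i T"
      have fin: "finite (sym_diff T U)"
        using less.prems U finite_subset[of _ "{1..n}"] by auto
      have diff: "sym_diff ?T U = sym_diff T U - {i}"
        using i unfolding sym_diff_flip by (simp add: flip_def)
      have IH: "lookup s T' = 0" if "T' \<subseteq> {1..n}" "sym_diff T' U \<subset> sym_diff T U" for T'
        using less.hyps[OF _ that(1)] psubset_card_mono[OF fin that(2)] by blast
      have T: "?T \<subseteq> {1..n}"
        using less.prems i_le by (auto simp: flip_def)
      have zero: "lookup s ?T = 0"
        using T i diff by (intro IH) auto
      have up: "lookup (gen_act (up_gen U j) s) ?T = 0" if j: "j \<in> {1..n}" for j
      proof (cases "j \<in> sym_diff ?T U")
        case True
        have "sym_diff (flip j ?T) U = sym_diff T U - {i} - {j}"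
          using True unfolding sym_diff_flip[of j] diff by (simp add: flip_def)
        moreover have "sym_diff T U - {i} - {j} \<subset> sym_diff T U"
          using i by blast
        ultimately have "sym_diff (flip j ?T) U \<subset> sym_diff T U"
          by (simp only:)
        moreover have "flip j ?T \<subseteq> {1..n}"
          using T j unfolding flip_def[of j] by auto
        ultimately have "lookup s (flip j ?T) = 0"
          by (intro IH)
        then show ?thesis
          by (simp add: lookup_up_gen)
      qed (simp only: lookup_up_gen if_False)
      have "0 = lookup (clifford_act n (v i) s) ?T"
        using ann[OF i_le] by simp
      also have "\<dots> = (\<Sum>j\<in>{1..n}. (if i = j then 1 else 0) * lookup (gen_act (down_gen U j) s) ?T)"
        using v[OF i_le] up zero by (simp add: lookup_clifford_act[of _ _ _ _ U] lookup_gen_act_E0)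
      also have "\<dots> = lookup (gen_act (down_gen U i) s) ?T"
        using i_le by (simp add: if_distrib[of "\<lambda>x. x * _"] cong: if_cong)
      also have "\<dots> = flip_sign i ?T * lookup s T"
        using diff by (simp add: lookup_down_gen)
      finally show ?thesis by simp
    qed (simp add: sU)
  qed
  then show "lookup s T = lookup 0 T"
    using s by (cases "T \<subseteq> {1..n}") (auto simp: spinor_space_def in_keys_iff)
qed

section \<open>Vanishing of the quadrics on pure spinors\<close>

lemma poly_eval_act_Var: "poly_eval (act g (Var S)) s = lookup (gen_act g s) S"
  by (simp add: poly_eval_coord_act)

text \<open>Each summand is unchanged when \<open>E i\<close> and \<open>F i\<close> are exchanged,
  so the quadric can be computed in any polarization.\<close>

lemma poly_eval_quadric:
  "poly_eval (quadric n S T) s =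
    2 * (\<Sum>i\<in>{1..n}. lookup (gen_act (up_gen U i) s) S * lookup (gen_act (down_gen U i) s) T
      + lookup (gen_act (down_gen U i) s) S * lookup (gen_act (up_gen U i) s) T)
    + lookup (gen_act E0 s) S * lookup (gen_act E0 s) T - lookup s S * lookup s T"
proof -
  have "(\<Sum>i\<in>{1..n}. lookup (gen_act (E i) s) S * lookup (gen_act (F i) s) T
      + lookup (gen_act (F i) s) S * lookup (gen_act (E i) s) T)
    = (\<Sum>i\<in>{1..n}. lookup (gen_act (up_gen U i) s) S * lookup (gen_act (down_gen U i) s) T
      + lookup (gen_act (down_gen U i) s) S * lookup (gen_act (up_gen U i) s) T)"
    by (intro sum.cong refl) (simp add: up_gen_def down_gen_def)
  then show ?thesis
    unfolding casimir_form_def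
    by (simp add: poly_eval_act_Var del: der_Var) simp
qed

text \<open>
  In the proof, \<open>u\<close> is a unit vector orthogonal to \<open>L\<close>, and the quadric takes the value
  \<open>(us)_S (us)_T - s_S s_T\<close>.
\<close>

lemma quadric_vanishes:
  assumes L: "L \<in> OGr n" and s: "s \<in> spin_embedding n L"
  shows "poly_eval (quadric n S T) s = 0"
proof (cases "s = 0")
  case True
  then show ?thesis
    by (simp add: poly_eval_quadric[of _ _ _ _ "{}"])
next
  case False
  then obtain U where sU: "lookup s U \<noteq> 0"
    by (metis poly_mapping_eqI lookup_zero)
  have sp: "s \<in> spinor_space n" and ann: "\<And>v. v \<in> L \<Longrightarrow> clifford_act n v s = 0"
    using s by (auto simp: spin_embedding_def)
  have U: "U \<subseteq> {1..n}"
    using sp sU by (auto simp: spinor_space_def in_keys_iff)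
  obtain v where vL: "\<And>i. i \<in> {1..n} \<Longrightarrow> v i \<in> L"
    and v: "\<And>i j. i \<in> {1..n} \<Longrightarrow> j \<in> {1..n} \<Longrightarrow> lookup (v i) (down_gen U j) = (if i = j then 1 else 0)"
    using isotropic_graph_basis[OF L ann sU] by metis
  define c where "c i = lookup (v i) E0" for i
  define A where "A i j = lookup (v i) (up_gen U j)" for i j
  have delta: "(\<Sum>k\<in>{1..n}. h k * (if i = k then 1 else 0)) = h i" if "i \<in> {1..n}"
    for h :: "nat \<Rightarrow> complex" and i
    using that by (simp add: if_distrib[of "(*) _"] cong: if_cong)
  have sub: "pm.subspace L" and iso: "\<And>x. x \<in> L \<Longrightarrow> qform n x = 0"
    using L by (auto simp: OGr_def)
  \<comment> \<open>\<open>A\<close> and \<open>c\<close> hold the \<open>up_gen\<close> and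
    \<open>E0\<close> parts of the graph basis; isotropy determines the symmetric part of
    \<open>A\<close> from \<open>c\<close>.\<close>
  have diag: "A i i + (c i)\<^sup>2 = 0" if "i \<in> {1..n}" for i
    using iso[OF vL[OF that]] delta[OF that, of "A i"]
    by (simp add: qform_up_down[of _ _ U] v[OF that] A_def c_def)
  have skew: "A i j + A j i = - 2 * c i * c j" if ij: "i \<in> {1..n}" "j \<in> {1..n}" for i j
  proof -
    have "0 = qform n (v i + v j)"
      using iso pm.subspace_add[OF sub vL vL] ij by simp
    also have "\<dots> = (\<Sum>k\<in>{1..n}. (A i k + A j k) * (if i = k then 1 else 0))
        + (\<Sum>k\<in>{1..n}. (A i k + A j k) * (if j = k then 1 else 0)) + (c i + c j)\<^sup>2"
      unfolding qform_up_down[of _ _ U] sum.distrib[symmetric]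
      by (intro arg_cong2[of _ _ _ _ "(+)"] sum.cong refl)
        (simp_all add: lookup_add v[OF ij(1)] v[OF ij(2)] A_def c_def algebra_simps)
    also have "\<dots> = A i i + A j i + (A i j + A j j) + (c i + c j)\<^sup>2"
      by (simp only: delta[OF ij(1)] delta[OF ij(2)])
    finally have "A i i + A j i + (A i j + A j j) + (c i + c j)\<^sup>2 = 0" ..
    moreover have "A i j + A j i + 2 * c i * c j = (A i i + A j i + (A i j + A j j) + (c i + c j)\<^sup>2)
        - (A i i + (c i)\<^sup>2) - (A j j + (c j)\<^sup>2)"
      by (simp add: power2_eq_square algebra_simps)
    ultimately have "A i j + A j i + 2 * c i * c j = 0"
      unfolding diag[OF ij(1)] diag[OF ij(2)] by simp
    then show ?thesis
      by (simp add: eq_neg_iff_add_eq_0)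
  qed
  \<comment> \<open>The polar form of \<open>u\<close> and \<open>v i\<close> is the coefficient of
    \<open>u\<close> at \<open>up_gen U i\<close> plus \<open>2 * c i\<close>; the choice
    \<open>- 2 * c k\<close> makes it 0.\<close>
  define u where "u = single E0 1 + (\<Sum>k\<in>{1..n}. single (up_gen U k) (- 2 * c k))"
  have u: "lookup u E0 = 1" "\<And>k. k \<in> {1..n} \<Longrightarrow> lookup u (up_gen U k) = - 2 * c k"
    "\<And>k. k \<in> {1..n} \<Longrightarrow> lookup u (down_gen U k) = 0"
    by (simp_all add: u_def lookup_add lookup_sum lookup_single when_def)
  have qu: "qform n u = 1"
    by (simp add: qform_up_down[of _ _ U] u)
  have quv: "qform n (u + v i) = 1" if i: "i \<in> {1..n}" for i
  proof -
    have "qform n (u + v i) = (\<Sum>k\<in>{1..n}. (- 2 * c k + A i k) * (if i = k then 1 else 0)) + (1 + c i)\<^sup>2"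
      unfolding qform_up_down[of _ _ U]
      by (intro arg_cong2[of _ _ _ _ "(+)"] sum.cong refl) (simp_all add: lookup_add v[OF i] u A_def c_def)
    also have "\<dots> = 1"
      using diag[OF i] unfolding delta[OF i] by (simp add: power2_eq_square algebra_simps)
    finally show ?thesis .
  qed
  let ?us = "clifford_act n u s"
  \<comment> \<open>\<open>u\<close> and \<open>u + v i\<close> both square to 1 and send
    \<open>s\<close> to the same spinor \<open>?us\<close>, so they also agree on
    \<open>?us\<close>.\<close>
  have vus: "clifford_act n (v i) ?us = 0" if i: "i \<in> {1..n}" for i
  proof -
    have "clifford_act n (u + v i) (clifford_act n (u + v i) s) = s"
      using clifford_relation[OF sp] by (simp add: quv[OF i])
    moreover have "clifford_act n (u + v i) s = ?us"
      by (simp add: clifford_act_add_left ann vL[OF i])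
    moreover have "clifford_act n u ?us = s"
      using clifford_relation[OF sp] by (simp add: qu)
    ultimately show ?thesis
      by (simp add: clifford_act_add_left)
  qed
  have lookup_us: "lookup ?us X = lookup (gen_act E0 s) X
      - 2 * (\<Sum>k\<in>{1..n}. c k * lookup (gen_act (up_gen U k) s) X)" for X
    by (simp add: lookup_clifford_act[of _ _ _ _ U] u sum_negf sum_distrib_left mult.assoc)
  define \<epsilon> :: complex where "\<epsilon> = (-1) ^ card U"
  have \<epsilon>: "\<epsilon> * \<epsilon> = 1"
    by (simp add: \<epsilon>_def flip: power_mult_distrib)
  \<comment> \<open>Both spinors are killed by the graph basis, and they agree at \<open>U\<close>,
    where the \<open>up_gen\<close> terms vanish.\<close>
  have "?us - pm_scale \<epsilon> s = 0"
  proof (rule spinor_eq_0_if_annihilated[OF _ U _ _ v])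
    show "?us - pm_scale \<epsilon> s \<in> spinor_space n"
      by (intro pm.subspace_diff pm.subspace_scale subspace_spinor_space clifford_act_spinor sp)
    show "lookup (?us - pm_scale \<epsilon> s) U = 0"
      by (simp add: lookup_minus lookup_us lookup_up_gen lookup_gen_act_E0 \<epsilon>_def)
    show "clifford_act n (v i) (?us - pm_scale \<epsilon> s) = 0" if "i \<in> {1..n}" for i
      by (simp add: clifford_act_diff clifford_act_scale vus[OF that] ann[OF vL[OF that]])
  qed
  then have us: "lookup (gen_act E0 s) X - 2 * (\<Sum>k\<in>{1..n}. c k * lookup (gen_act (up_gen U k) s) X)
      = \<epsilon> * lookup s X" for X
    using lookup_us[of X] by simp
  \<comment> \<open>Solving the relation that \<open>v i\<close> kills \<open>s\<close> for the
    \<open>down_gen\<close> coordinate leaves only \<open>up_gen\<close> and \<open>E0\<close>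
    coordinates in the quadric.\<close>
  have down: "lookup (gen_act (down_gen U i) s) X = - c i * lookup (gen_act E0 s) X
      - (\<Sum>j\<in>{1..n}. A i j * lookup (gen_act (up_gen U j) s) X)" if i: "i \<in> {1..n}" for i X
  proof -
    have "0 = lookup (clifford_act n (v i) s) X"
      using ann[OF vL[OF i]] by simp
    also have "\<dots> = (\<Sum>j\<in>{1..n}. A i j * lookup (gen_act (up_gen U j) s) X)
        + (\<Sum>j\<in>{1..n}. lookup (gen_act (down_gen U j) s) X * (if i = j then 1 else 0))
        + c i * lookup (gen_act E0 s) X"
      using v[OF i] by (simp add: lookup_clifford_act[of _ _ _ _ U] A_def c_def mult.commute)
    finally show ?thesis
      unfolding delta[OF i] by (simp add: algebra_simps eq_neg_iff_add_eq_0)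
  qed
  define a where "a i X = lookup (gen_act (up_gen U i) s) X" for i X
  define e where "e X = lookup (gen_act E0 s) X" for X
  \<comment> \<open>After this substitution \<open>A\<close> enters only through
    \<open>A i j + A j i\<close>, which \<open>skew\<close> turns into products of the
    \<open>c\<close>; the value then factors.\<close>
  have "2 * (\<Sum>i\<in>{1..n}. a i S * lookup (gen_act (down_gen U i) s) T
      + lookup (gen_act (down_gen U i) s) S * a i T)
    = 2 * (\<Sum>i\<in>{1..n}. - (c i * a i S * e T) - e S * (c i * a i T)
        - (\<Sum>j\<in>{1..n}. A i j * (a i S * a j T)) - (\<Sum>j\<in>{1..n}. A i j * (a j S * a i T)))"
    by (intro arg_cong2[of _ _ _ _ "(*)"] sum.cong refl)
      (simp add: down a_def[symmetric] e_def[symmetric] algebra_simps sum_distrib_left)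
  also have "\<dots> = - 2 * (\<Sum>i\<in>{1..n}. c i * a i S) * e T - 2 * e S * (\<Sum>i\<in>{1..n}. c i * a i T)
      - 2 * ((\<Sum>i\<in>{1..n}. \<Sum>j\<in>{1..n}. A i j * (a i S * a j T)) + (\<Sum>i\<in>{1..n}. \<Sum>j\<in>{1..n}. A i j * (a j S * a i T)))"
    by (simp add: sum_subtractf sum_negf sum.distrib sum_distrib_left sum_distrib_right algebra_simps)
  also have "(\<Sum>i\<in>{1..n}. \<Sum>j\<in>{1..n}. A i j * (a j S * a i T)) = (\<Sum>i\<in>{1..n}. \<Sum>j\<in>{1..n}. A j i * (a i S * a j T))"
    by (rule sum.swap)
  also have "(\<Sum>i\<in>{1..n}. \<Sum>j\<in>{1..n}. A i j * (a i S * a j T)) + \<dots>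
      = (\<Sum>i\<in>{1..n}. \<Sum>j\<in>{1..n}. (A i j + A j i) * (a i S * a j T))"
    by (simp add: sum.distrib distrib_right)
  also have "\<dots> = (\<Sum>i\<in>{1..n}. \<Sum>j\<in>{1..n}. - 2 * ((c i * a i S) * (c j * a j T)))"
    by (intro sum.cong refl) (simp add: skew)
  also have "\<dots> = - 2 * ((\<Sum>i\<in>{1..n}. c i * a i S) * (\<Sum>j\<in>{1..n}. c j * a j T))"
    unfolding sum_product by (simp only: sum_distrib_left)
  finally have "poly_eval (quadric n S T) s =
      (e S - 2 * (\<Sum>i\<in>{1..n}. c i * a i S)) * (e T - 2 * (\<Sum>i\<in>{1..n}. c i * a i T)) - lookup s S * lookup s T"
    unfolding poly_eval_quadric[of _ _ _ _ U] a_def[symmetric] e_def[symmetric]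
    by (simp add: algebra_simps)
  also have "\<dots> = (\<epsilon> * lookup s S) * (\<epsilon> * lookup s T) - lookup s S * lookup s T"
    unfolding a_def e_def us ..
  also have "\<dots> = 0"
    using \<epsilon> by simp
  finally show ?thesis .
qed

section \<open>Pure spinors generated from the vacuum\<close>

text \<open>The steps are the maps exp (t e_i), since e_i squares to 0. Closure under them for all
  \<open>t\<close> makes the vanishing ideal stable under \<open>act (E i)\<close>, and all nonzero
  multiples of the vacuum are included to detect polynomials in the vacuum coordinate.\<close>

inductive_set orbit :: "nat \<Rightarrow> (nat set \<Rightarrow>\<^sub>0 complex) set" for n where
  vacuum: "t \<noteq> 0 \<Longrightarrow> single {} t \<in> orbit n"
| translate: "s \<in> orbit n \<Longrightarrow> i \<in> {1..n} \<Longrightarrow> s + pm_scale t (gen_act (E i) s) \<in> orbit n"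

text \<open>Spanned by e_0 and the e_i, all orthogonal to every e_i, so that e_i anticommutes with
  its elements. The annihilator of an orbit spinor is found as the graph of a map from the span of
  the f_j into this space.\<close>

definition lower_space :: "nat \<Rightarrow> (qbasis \<Rightarrow>\<^sub>0 complex) set" where
  "lower_space n = {w. keys w \<subseteq> insert E0 (E ` {1..n})}"

lemma subspace_lower_space: "pm.subspace (lower_space n)"
proof (rule pm.subspaceI)
  show "x + y \<in> lower_space n" if "x \<in> lower_space n" "y \<in> lower_space n" for x y
    using that keys_add[of x y] unfolding lower_space_def by blast
  show "pm_scale c x \<in> lower_space n" if "x \<in> lower_space n" for c x
    using that keys_pm_scale_subset[of c x] unfolding lower_space_def by blast
qed (simp add: lower_space_def)

lemma gen_act_lower_anticommute:
  assumes "w \<in> lower_space n" "s \<in> spinor_space n"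
  shows "gen_act (E i) (clifford_act n w s) = - clifford_act n w (gen_act (E i) s)"
proof -
  have "pm_scale (lookup w g) (gen_act (E i) (gen_act g s)) = pm_scale (lookup w g) (- gen_act g (gen_act (E i) s))"
    for g
  proof (cases "lookup w g = 0")
    case False
    then have "g \<in> insert E0 (E ` {1..n})"
      using assms(1) by (auto simp: lower_space_def in_keys_iff)
    then have "qpolar (E i) g = 0" by auto
    then have "gen_act (E i) (gen_act g s) = - gen_act g (gen_act (E i) s)"
      using gen_act_anticommute[OF assms(2), of "E i" g] by (simp add: eq_neg_iff_add_eq_0)
    then show ?thesis by simp
  qed simp
  then show ?thesis
    by (simp add: clifford_act_def gen_act_sum gen_act_scale sum_negf)
qed

text \<open>
  The existence of \<open>u\<close> makes the induction work: it allows \<open>s\<close> itself to be written as an element of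
  \<open>lower_space n\<close> acting on the new spinor \<open>s + t e_i s\<close>.
\<close>

lemma orbit_lower:
  assumes "s \<in> orbit n"
  shows "s \<in> spinor_space n \<and> lookup s {} \<noteq> 0 \<and> (\<exists>u\<in>lower_space n. clifford_act n u s = s)
    \<and> (\<forall>j\<in>{1..n}. \<exists>w\<in>lower_space n. gen_act (F j) s = clifford_act n w s)"
  using assms
proof induction
  case (vacuum t)
  have "gen_act (F j) (single {} t) = clifford_act n 0 (single {} t)" for j
    by (simp add: gen_act_single)
  moreover have "clifford_act n (single E0 1) (single {} t) = single {} t"
    by (simp add: clifford_act_single gen_act_single)
  moreover have "single E0 1 \<in> lower_space n" "0 \<in> lower_space n"
    by (auto simp: lower_space_def)
  ultimately show ?case
    using vacuum by (intro conjI ballI bexI[of _ "single E0 1"] bexI[of _ 0])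
      (auto simp: spinor_space_def)
next
  case (translate s i t)
  let ?es = "gen_act (E i) s"
  let ?s = "s + pm_scale t ?es"
  from translate obtain u where sp: "s \<in> spinor_space n" and vac: "lookup s {} \<noteq> 0"
    and u: "u \<in> lower_space n" "clifford_act n u s = s"
    and w: "\<And>j. j \<in> {1..n} \<Longrightarrow> \<exists>w\<in>lower_space n. gen_act (F j) s = clifford_act n w s"
    by blast
  have ee: "gen_act (E i) ?es = 0"
  proof -
    have "gen_act (E i) ?es + gen_act (E i) ?es = 0"
      using gen_act_anticommute[OF sp, of "E i" "E i"] by simp
    then have "pm_scale 2 (gen_act (E i) ?es) = 0"
      using pm.scale_left_distrib[of 1 1 "gen_act (E i) ?es"] by simp
    then show ?thesis by simp
  qed
  have Ei: "single (E i) c \<in> lower_space n" for c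
    using translate.hyps(2) by (auto simp: lower_space_def)
  have es: "?es = gen_act (E i) ?s"
    by (simp add: gen_act_add gen_act_scale ee)
  have us: "clifford_act n u ?s = s - pm_scale t ?es"
  proof -
    have "clifford_act n u ?es = - ?es"
      using gen_act_lower_anticommute[OF u(1) sp, of i] u(2) by (metis minus_minus)
    then show ?thesis
      by (simp add: clifford_act_add clifford_act_scale u(2))
  qed
  have single: "clifford_act n (single (E i) c) ?s = pm_scale c ?es" for c
    using translate.hyps(2) by (subst (2) es) (simp add: clifford_act_single)
  \<comment> \<open>As \<open>u\<close> fixes \<open>s\<close> and anticommutes with e_i, it sends
    \<open>?s\<close> to s - t e_i s. Adding \<open>t\<close> or \<open>2 * t\<close> times e_i,
    which maps \<open>?s\<close> to e_i s, yields \<open>s\<close> or \<open>?s\<close>.\<close>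
  have s_eq: "s = clifford_act n (u + single (E i) t) ?s"
    unfolding clifford_act_add_left us single by simp
  have s'_eq: "clifford_act n (u + single (E i) (2 * t)) ?s = ?s"
    unfolding clifford_act_add_left us single by (simp flip: pm.scale_left_distrib pm.scale_left_diff_distrib)
  have spin: "?s \<in> spinor_space n"
    using sp translate.hyps(2)
    by (intro pm.subspace_add pm.subspace_scale subspace_spinor_space gen_act_spinor) auto
  have vac': "lookup ?s {} \<noteq> 0"
    using vac lookup_up_gen[of "{}" i s "{}"] by (simp add: lookup_add up_gen_def)
  have "\<exists>w'\<in>lower_space n. gen_act (F j) ?s = clifford_act n w' ?s" if j: "j \<in> {1..n}" for j
  proof -
    obtain w where w: "w \<in> lower_space n" "gen_act (F j) s = clifford_act n w s"
      using w[OF j] by blast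
    \<comment> \<open>Moving f_j past e_i leaves a multiple of \<open>s\<close>, the only term not
      yet of the form lower vector acting on \<open>?s\<close>; \<open>s_eq\<close> rewrites
      it.\<close>
    define d where "d = qpolar (F j) (E i)"
    have "gen_act (F j) ?es = pm_scale d s - gen_act (E i) (gen_act (F j) s)"
      using gen_act_anticommute[OF sp, of "F j" "E i"] unfolding d_def by (simp add: eq_diff_eq)
    also have "\<dots> = pm_scale d s + clifford_act n w ?es"
      using gen_act_lower_anticommute[OF w(1) sp] by (simp add: w(2))
    finally have "gen_act (F j) ?s = clifford_act n w ?s + pm_scale (t * d) s"
      by (simp add: gen_act_add gen_act_scale clifford_act_add clifford_act_scale w(2) pm.scale_right_distrib)
    also have "\<dots> = clifford_act n (w + pm_scale (t * d) (u + single (E i) t)) ?s"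
      by (subst (2) s_eq) (simp only: clifford_act_add_left clifford_act_scale_left)
    finally have "gen_act (F j) ?s = clifford_act n (w + pm_scale (t * d) (u + single (E i) t)) ?s" .
    moreover have "w + pm_scale (t * d) (u + single (E i) t) \<in> lower_space n"
      by (intro pm.subspace_add pm.subspace_scale subspace_lower_space w(1) u(1) Ei)
    ultimately show ?thesis by blast
  qed
  then show ?case
    using spin vac' s'_eq u(1) Ei pm.subspace_add[OF subspace_lower_space] by blast
qed

text \<open>The vectors f_j - w_j annihilate \<open>s\<close> and are independent by their
  \<open>F\<close> coordinates. Their span is isotropic because v v s is q(v) times
  \<open>s\<close>, and \<open>s\<close> is nonzero.\<close>

lemma orbit_pure:
  assumes "s \<in> orbit n"
  obtains L where "L \<in> OGr n" "s \<in> spin_embedding n L" "s \<noteq> 0"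
proof -
  from orbit_lower[OF assms] have sp: "s \<in> spinor_space n" and s: "lookup s {} \<noteq> 0"
    and "\<forall>j\<in>{1..n}. \<exists>w\<in>lower_space n. gen_act (F j) s = clifford_act n w s"
    by auto
  then obtain w where w: "\<And>j. j \<in> {1..n} \<Longrightarrow> w j \<in> lower_space n"
    "\<And>j. j \<in> {1..n} \<Longrightarrow> gen_act (F j) s = clifford_act n (w j) s"
    by metis
  define x where "x j = single (F j) 1 - w j" for j
  have lookup_x: "lookup (x j) (F k) = (if k = j then 1 else 0)" if "j \<in> {1..n}" for j k
    using w(1)[OF that] by (auto simp: x_def lookup_minus lookup_single when_def lower_space_def in_keys_iff)
  have inj: "inj_on x {1..n}"
    using lookup_x by (intro inj_onI) (metis zero_neq_one)
  let ?X = "x ` {1..n}"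
  have ind: "pm.independent ?X"
  proof -
    have "c (x k) = 0" if c: "(\<Sum>y\<in>?X. pm_scale (c y) y) = 0" and k: "k \<in> {1..n}" for c k
    proof -
      have "0 = lookup (\<Sum>y\<in>?X. pm_scale (c y) y) (F k)"
        using c by simp
      also have "\<dots> = (\<Sum>j\<in>{1..n}. c (x j) * lookup (x j) (F k))"
        unfolding lookup_sum sum.reindex[OF inj] by simp
      also have "\<dots> = c (x k)"
        using k by (simp add: lookup_x if_distrib[of "(*) _"] cong: if_cong)
      finally show ?thesis by simp
    qed
    then show ?thesis
      by (subst pm.dependent_finite) auto
  qed
  have ann: "clifford_act n v s = 0" if "v \<in> pm.span ?X" for v
    using that
  proof (induction rule: pm.span_induct_alt)
    case (step c b y)
    then show ?case
      by (auto simp: clifford_act_add_left clifford_act_scale_left x_def clifford_act_diff_left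
          clifford_act_single w(2))
  qed simp
  have s0: "s \<noteq> 0"
    using s by auto
  have "pm.span ?X \<subseteq> qspace n"
  proof (rule pm.span_minimal)
    show "pm.subspace (qspace n)"
    proof (rule pm.subspaceI)
      show "x + y \<in> qspace n" if "x \<in> qspace n" "y \<in> qspace n" for x y
        using that keys_add[of x y] unfolding qspace_def by blast
      show "pm_scale c x \<in> qspace n" if "x \<in> qspace n" for c x
        using that keys_pm_scale_subset[of c x] unfolding qspace_def by blast
    qed (simp add: qspace_def)
    show "?X \<subseteq> qspace n"
    proof
      fix y assume "y \<in> ?X"
      then obtain j where j: "j \<in> {1..n}" "y = x j" by blast
      have "keys y \<subseteq> keys (single (F j) (1::complex)) \<union> keys (w j)"
        unfolding j x_def by (rule keys_diff)
      also have "\<dots> \<subseteq> qbasis_set n"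
        using w(1)[OF j(1)] j(1) by (auto simp: lower_space_def qbasis_set_def)
      finally show "y \<in> qspace n"
        by (simp add: qspace_def)
    qed
  qed
  moreover have "qform n v = 0" if "v \<in> pm.span ?X" for v
    using clifford_relation[OF sp, of v] ann[OF that] s0 by (simp add: clifford_act_def)
  moreover have "pm.dim (pm.span ?X) = n"
    using pm.dim_span_eq_card_independent[OF ind] card_image[OF inj] by simp
  ultimately have "pm.span ?X \<in> OGr n"
    by (simp add: OGr_def)
  moreover have "s \<in> spin_embedding n (pm.span ?X)"
    using sp ann by (simp add: spin_embedding_def)
  ultimately show thesis
    using s0 that by blast
qed

section \<open>The ideal of the spinor variety\<close>

lemma quadric_polys: "S \<subseteq> {1..n} \<Longrightarrow> T \<subseteq> {1..n} \<Longrightarrow> quadric n S T \<in> polys n"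
  unfolding casimir_form_def
  by (intro polys_add polys_diff polys_scale polys_sum polys_mult act_polys euler_polys) auto

lemma ideal_spinor_ideal: "ideal (spinor_ideal n) (coord_ring n)"
proof -
  interpret cring "coord_ring n"
    by (rule coord_ring_cring)
  have "subgroup (spinor_ideal n) (add_monoid (coord_ring n))"
  proof (rule add.subgroupI)
    show "spinor_ideal n \<subseteq> carrier (coord_ring n)"
      by (auto simp: spinor_ideal_def)
    have "\<zero>\<^bsub>coord_ring n\<^esub> \<in> spinor_ideal n"
      by (simp add: polys_ring_simps spinor_ideal_def)
    then show "spinor_ideal n \<noteq> {}" by blast
  next
    fix a assume a: "a \<in> spinor_ideal n"
    then have "\<ominus>\<^bsub>coord_ring n\<^esub> a = - a"
      by (intro minus_equality) (auto simp: polys_ring_simps spinor_ideal_def)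
    then show "\<ominus>\<^bsub>coord_ring n\<^esub> a \<in> spinor_ideal n"
      using a by (auto simp: spinor_ideal_def)
  next
    fix a b assume "a \<in> spinor_ideal n" "b \<in> spinor_ideal n"
    then show "a \<oplus>\<^bsub>coord_ring n\<^esub> b \<in> spinor_ideal n"
      by (auto simp: spinor_ideal_def polys_ring_simps)
  qed
  then show ?thesis
    by (intro idealI ring_axioms) (auto simp: spinor_ideal_def polys_ring_simps)
qed

lemma quadric_ideal_subset: "quadric_ideal n \<subseteq> spinor_ideal n"
  unfolding quadric_ideal_def
proof (rule pm.span_minimal)
  show "pm.subspace (spinor_ideal n)"
    by (rule pm.subspaceI) (auto simp: spinor_ideal_def)
  show "{single m 1 * quadric n S T | m S T. keys m \<subseteq> Pow {1..n} \<and> S \<subseteq> {1..n} \<and> T \<subseteq> {1..n}}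
      \<subseteq> spinor_ideal n"
  proof clarify
    fix m :: monom and S T
    assume "keys m \<subseteq> Pow {1..n}" "S \<subseteq> {1..n}" "T \<subseteq> {1..n}"
    then have "single m 1 * quadric n S T \<in> polys n"
      by (intro polys_mult polys_single quadric_polys)
    then show "single m 1 * quadric n S T \<in> spinor_ideal n"
      using quadric_vanishes by (auto simp: spinor_ideal_def)
  qed
qed

text \<open>Contains \<open>spinor_ideal n\<close> because orbit spinors are pure. It takes the
  place of that ideal in the induction, its stability under \<open>act (E i)\<close> being immediate
  from the closure of the orbit.\<close>

definition orbit_ideal :: "nat \<Rightarrow> poly set" where
  "orbit_ideal n = {f \<in> polys n. \<forall>s\<in>orbit n. poly_eval f s = 0}"

lemma spinor_ideal_orbit: "spinor_ideal n \<subseteq> orbit_ideal n"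
  unfolding spinor_ideal_def orbit_ideal_def by (auto elim!: orbit_pure)

text \<open>The curve s + t e_i s stays in the orbit, so \<open>f\<close> vanishes along it, and the
  derivative at t = 0 is the value of \<open>act (E i) f\<close> at \<open>s\<close>.\<close>

lemma orbit_ideal_act_E:
  assumes f: "f \<in> orbit_ideal n" and i: "i \<in> {1..n}"
  shows "act (E i) f \<in> orbit_ideal n"
proof -
  have fp: "f \<in> polys n"
    using f by (simp add: orbit_ideal_def)
  have "poly_eval (act (E i) f) s = 0" if s: "s \<in> orbit n" for s
  proof -
    let ?\<gamma> = "\<lambda>t. s + pm_scale t (gen_act (E i) s)"
    have "((\<lambda>t. poly_eval f (?\<gamma> t)) has_field_derivative poly_eval (act (E i) f) (?\<gamma> 0)) (at 0)"
    proof (rule poly_eval_has_derivative[OF fp])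
      fix S
      have "((\<lambda>t. lookup s S + t * lookup (gen_act (E i) s) S) has_field_derivative lookup (gen_act (E i) s) S) (at 0)"
        by (auto intro!: derivative_eq_intros)
      then show "((\<lambda>t. lookup (?\<gamma> t) S) has_field_derivative poly_eval (coord_act (E i) S) (?\<gamma> 0)) (at 0)"
        unfolding poly_eval_coord_act by (simp add: lookup_add)
    qed
    moreover have "(\<lambda>t. poly_eval f (?\<gamma> t)) = (\<lambda>t. 0)"
      using f orbit.translate[OF s i] by (auto simp: orbit_ideal_def)
    ultimately have "((\<lambda>t. 0) has_field_derivative poly_eval (act (E i) f) s) (at 0)"
      by simp
    then show ?thesis
      using DERIV_unique DERIV_const by blast
  qed
  then show ?thesis
    using act_polys[OF fp] i by (simp add: orbit_ideal_def)
qed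

text \<open>On multiples of the vacuum \<open>g\<close> becomes a one-variable polynomial with the
  same coefficients and infinitely many roots.\<close>

lemma vacuum_polynomial_eq_0:
  assumes keys: "\<And>m. m \<in> keys g \<Longrightarrow> keys m \<subseteq> {{}}"
    and eval: "\<And>t. t \<noteq> 0 \<Longrightarrow> poly_eval g (single {} t) = 0"
  shows "g = 0"
proof (rule ccontr)
  assume "g \<noteq> 0"
  then obtain m where m: "m \<in> keys g"
    by (metis keys_eq_empty ex_in_conv)
  define N where "N = Max ((\<lambda>m. lookup m {}) ` keys g)"
  have single: "m' = single {} (lookup m' {})" if "keys m' \<subseteq> {{}}" for m' :: monom
  proof (rule poly_mapping_eqI)
    fix k
    show "lookup m' k = lookup (single {} (lookup m' {})) k"
    proof (cases "k = {}")
      case False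
      then have "k \<notin> keys m'"
        using that by blast
      then show ?thesis
        using False by (simp add: in_keys_iff lookup_single when_def)
    qed simp
  qed
  have le: "lookup m' {} \<le> N" if "m' \<in> keys g" for m'
    using that by (simp add: N_def)
  have sub: "keys g \<subseteq> single {} ` {..N}"
    using single[OF keys] le by blast
  have "poly_eval g (single {} t) = (\<Sum>k\<le>N. lookup g (single {} k) * t ^ k)" for t
  proof -
    have "eval_mon (single {} t) (single {} k) = t ^ k" for k
      by (simp add: eval_mon_superset[of "{{}}"])
    moreover have "inj_on (single {} :: nat \<Rightarrow> monom) {..N}"
      by (intro inj_onI) (metis lookup_single_eq)
    ultimately show ?thesis
      by (simp add: poly_eval_superset[OF _ sub] sum.reindex)
  qed
  then have "UNIV - {0} \<subseteq> {t. (\<Sum>k\<le>N. lookup g (single {} k) * t ^ k) = 0}"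
    using eval by auto
  moreover have "infinite (UNIV - {0 :: complex})"
    using infinite_UNIV_char_0 by simp
  ultimately have "infinite {t. (\<Sum>k\<le>N. lookup g (single {} k) * t ^ k) = 0}"
    by (rule infinite_super)
  then have "\<forall>k\<le>N. lookup g (single {} k) = 0"
    by (simp add: polyfun_finite_roots)
  then have "lookup g m = 0"
    using single[OF keys[OF m]] le[OF m] by metis
  then show False
    using m by (simp add: in_keys_iff)
qed

text \<open>Induction on a strict bound \<open>w\<close> for the total size of the index sets, which
  \<open>act (E i)\<close> lowers. The part of \<open>f\<close> with nonzero eigenvalues lies in the
  quadric ideal; the rest is a polynomial in the vacuum coordinate that vanishes on the
  orbit.\<close>

lemma orbit_ideal_subset: "orbit_ideal n \<subseteq> quadric_ideal n"
proof -
  have sub: "quadric_ideal n \<subseteq> orbit_ideal n"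
    using quadric_ideal_subset spinor_ideal_orbit by blast
  have "f \<in> quadric_ideal n" if "f \<in> orbit_ideal n" "\<forall>m\<in>keys f. wt m < int w" for f w
    using that
  proof (induction w arbitrary: f)
    case 0
    have "wt m \<ge> 0" for m
      unfolding stat_def by (intro sum_nonneg) simp
    then have "keys f = {}"
      using 0(2) by (metis ex_in_conv of_nat_0 not_less)
    then show ?case
      using pm.subspace_0[OF subspace_quadric_ideal] by simp
  next
    case (Suc w)
    have f: "f \<in> polys n"
      using Suc.prems by (simp add: orbit_ideal_def)
    have "act (E i) f \<in> quadric_ideal n" if i: "i \<in> {1..n}" for i
    proof (rule Suc.IH[OF orbit_ideal_act_E[OF Suc.prems(1) i]], rule ballI)
      fix m assume "m \<in> keys (act (E i) f)"
      then obtain m' where "m' \<in> keys f" "wt m < wt m'"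
        by (rule wt_act_E_less[OF f])
      then show "wt m < int w"
        using Suc.prems(2) by fastforce
    qed
    then have diff: "f - restrict_keys (\<lambda>m. keys m \<subseteq> {{}}) f \<in> quadric_ideal n" (is "f - ?g \<in> _")
      by (rule quadric_ideal_eigencomponents[OF f])
    have "?g = 0"
    proof (rule vacuum_polynomial_eq_0)
      fix t :: complex assume "t \<noteq> 0"
      then have "single {} t \<in> orbit n"
        by (rule orbit.vacuum)
      then show "poly_eval ?g (single {} t) = 0"
        using diff sub Suc.prems(1) by (auto simp: orbit_ideal_def)
    qed (simp add: keys_restrict_keys)
    then show ?case
      using diff by simp
  qed
  moreover have "\<exists>w. \<forall>m\<in>keys f. wt m < int w" for f :: poly
  proof -
    have "\<forall>m\<in>keys f. wt m < int (nat (Max (wt ` keys f) + 1))"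
    proof
      fix m assume "m \<in> keys f"
      then have "wt m \<le> Max (wt ` keys f)" by simp
      then show "wt m < int (nat (Max (wt ` keys f) + 1))" by linarith
    qed
    then show ?thesis ..
  qed
  ultimately show ?thesis by blast
qed

lemma spinor_ideal_eq: "spinor_ideal n = quadric_ideal n"
  using quadric_ideal_subset spinor_ideal_orbit orbit_ideal_subset by blast

section \<open>The degree two piece generates\<close>

lemma monom_degree_add: "monom_degree (m + m') = monom_degree m + monom_degree m'"
  using stat_add[of "\<lambda>S. 1" m m'] by (simp flip: monom_degree_stat)

lemma monom_degree_quadric:
  assumes "m \<in> keys (quadric n S T)" "S \<subseteq> {1..n}" "T \<subseteq> {1..n}"
  shows "monom_degree m = 2"
  using quadric_stats(2)[OF assms] by (simp flip: monom_degree_stat)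

lemma monom_degree_eq_0: "monom_degree m = 0 \<longleftrightarrow> m = 0"
  by (auto simp: monom_degree_def in_keys_iff simp flip: keys_eq_empty)

lemma subspace_graded_piece:
  assumes "pm.subspace I"
  shows "pm.subspace (graded_piece d I)"
proof (rule pm.subspaceI)
  show "x + y \<in> graded_piece d I" if "x \<in> graded_piece d I" "y \<in> graded_piece d I" for x y
    using that keys_add[of x y] pm.subspace_add[OF assms] unfolding graded_piece_def by blast
  show "pm_scale c x \<in> graded_piece d I" if "x \<in> graded_piece d I" for c x
    using that keys_pm_scale_subset[of c x] pm.subspace_scale[OF assms] unfolding graded_piece_def by blast
qed (simp add: graded_piece_def pm.subspace_0[OF assms])

text \<open>A monomial \<open>m\<close> times a quadric is homogeneous of degree
  \<open>monom_degree m + 2\<close>, so projection to degree 2 keeps only the multiples with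
  \<open>m = 0\<close>.\<close>

lemma graded_piece_quadrics:
  "graded_piece 2 (spinor_ideal n) = pm.span {quadric n S T | S T. S \<subseteq> {1..n} \<and> T \<subseteq> {1..n}}"
    (is "_ = pm.span ?G")
proof
  show "pm.span ?G \<subseteq> graded_piece 2 (spinor_ideal n)"
    unfolding spinor_ideal_eq
    by (intro pm.span_minimal subspace_graded_piece subspace_quadric_ideal)
      (auto simp: graded_piece_def quadric_in_quadric_ideal monom_degree_quadric)
  show "graded_piece 2 (spinor_ideal n) \<subseteq> pm.span ?G"
  proof
    fix f assume f: "f \<in> graded_piece 2 (spinor_ideal n)"
    have "restrict_keys (\<lambda>m. monom_degree m = 2) f \<in> pm.span ?G"
    proof (rule restrict_keys_span[OF _ pm.subspace_span])
      show "f \<in> pm.span {single m 1 * quadric n S T | m S T.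
          keys m \<subseteq> Pow {1..n} \<and> S \<subseteq> {1..n} \<and> T \<subseteq> {1..n}}"
        using f by (simp add: graded_piece_def spinor_ideal_eq quadric_ideal_def)
    next
      fix b assume "b \<in> {single m 1 * quadric n S T | m S T.
          keys m \<subseteq> Pow {1..n} \<and> S \<subseteq> {1..n} \<and> T \<subseteq> {1..n}}"
      then obtain m S T where b: "b = single m 1 * quadric n S T" and ST: "S \<subseteq> {1..n}" "T \<subseteq> {1..n}"
        by blast
      have deg: "monom_degree x = monom_degree m + 2" if "x \<in> keys b" for x
        using that unfolding b
        by (elim keys_single_mult) (simp add: monom_degree_add monom_degree_quadric[OF _ ST])
      show "restrict_keys (\<lambda>m. monom_degree m = 2) b \<in> pm.span ?G"
      proof (cases "m = 0")
        case True
        then have "restrict_keys (\<lambda>m. monom_degree m = 2) b = quadric n S T"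
          using restrict_keys_id[of b "\<lambda>m. monom_degree m = 2"] deg monom_degree_eq_0[of m] by (simp add: b)
        then show ?thesis
          using ST pm.span_base[of "quadric n S T" ?G] by auto
      next
        case False
        then have "restrict_keys (\<lambda>m. monom_degree m = 2) b = 0"
          using deg monom_degree_eq_0[of m] by (intro restrict_keys_zero) simp
        then show ?thesis
          by (simp add: pm.span_zero)
      qed
    qed
    moreover have "restrict_keys (\<lambda>m. monom_degree m = 2) f = f"
      using f by (intro restrict_keys_id) (simp add: graded_piece_def)
    ultimately show "f \<in> pm.span ?G" by simp
  qed
qed

text \<open>Constants are polynomials, so the ring ideal is a complex subspace; with
  \<open>P\<close> it contains the span, hence all quadrics and their monomial multiples.\<close>

lemma genideal_spinor_ideal:
  assumes span: "pm.span P = graded_piece 2 (spinor_ideal n)"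
  shows "Idl\<^bsub>coord_ring n\<^esub> P = spinor_ideal n"
proof
  interpret cring "coord_ring n"
    by (rule coord_ring_cring)
  have P: "P \<subseteq> spinor_ideal n"
    using pm.span_superset[of P] span by (auto simp: graded_piece_def)
  then show "Idl\<^bsub>coord_ring n\<^esub> P \<subseteq> spinor_ideal n"
    by (intro genideal_minimal ideal_spinor_ideal)
  have "P \<subseteq> carrier (coord_ring n)"
    using P by (auto simp: spinor_ideal_def)
  then interpret K: ideal "Idl\<^bsub>coord_ring n\<^esub> P" "coord_ring n"
    by (rule genideal_ideal)
  have PK: "P \<subseteq> Idl\<^bsub>coord_ring n\<^esub> P"
    using \<open>P \<subseteq> carrier (coord_ring n)\<close> by (rule genideal_self)
  have mult: "f * k \<in> Idl\<^bsub>coord_ring n\<^esub> P" if "f \<in> polys n" "k \<in> Idl\<^bsub>coord_ring n\<^esub> P" for f k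
    using K.I_l_closed[OF that(2,1)] by (simp add: polys_ring_simps)
  have sub: "pm.subspace (Idl\<^bsub>coord_ring n\<^esub> P)"
  proof (rule pm.subspaceI)
    show "0 \<in> Idl\<^bsub>coord_ring n\<^esub> P"
      using K.zero_closed by (simp add: polys_ring_simps)
    show "x + y \<in> Idl\<^bsub>coord_ring n\<^esub> P" if "x \<in> Idl\<^bsub>coord_ring n\<^esub> P" "y \<in> Idl\<^bsub>coord_ring n\<^esub> P" for x y
      using K.a_closed[OF that] by (simp add: polys_ring_simps)
    show "pm_scale c x \<in> Idl\<^bsub>coord_ring n\<^esub> P" if "x \<in> Idl\<^bsub>coord_ring n\<^esub> P" for c x
      unfolding pm_scale_eq_mult using that by (intro mult polys_single) auto
  qed
  have "quadric n S T \<in> Idl\<^bsub>coord_ring n\<^esub> P" if "S \<subseteq> {1..n}" "T \<subseteq> {1..n}" for S T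
  proof -
    have "quadric n S T \<in> pm.span P"
      unfolding span graded_piece_quadrics using that by (intro pm.span_base) blast
    then show ?thesis
      using pm.span_minimal[OF PK sub] by blast
  qed
  then have "{single m 1 * quadric n S T | m S T. keys m \<subseteq> Pow {1..n} \<and> S \<subseteq> {1..n} \<and> T \<subseteq> {1..n}}
      \<subseteq> Idl\<^bsub>coord_ring n\<^esub> P"
    by (blast intro: mult polys_single)
  then show "spinor_ideal n \<subseteq> Idl\<^bsub>coord_ring n\<^esub> P"
    unfolding spinor_ideal_eq quadric_ideal_def by (intro pm.span_minimal sub)
qed

section \<open>Quadrics of full support\<close>

lemma exists_full_support:
  assumes V: "pm.subspace V" and "finite M" and "\<And>m. m \<in> M \<Longrightarrow> \<exists>v\<in>V. lookup v m \<noteq> 0"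
  shows "\<exists>u\<in>V. \<forall>m\<in>M. lookup u m \<noteq> 0"
  using assms(2,3)
proof (induction M)
  case empty
  then show ?case
    using pm.subspace_0[OF V] by blast
next
  case (insert m M)
  then obtain u v where u: "u \<in> V" "\<forall>m\<in>M. lookup u m \<noteq> 0" and v: "v \<in> V" "lookup v m \<noteq> 0"
    by (metis insertCI)
  \<comment> \<open>For each \<open>k\<close> with \<open>lookup u k\<close> nonzero one value of
    \<open>c\<close> is bad. If \<open>lookup u k = 0\<close>, then \<open>k\<close> is
    \<open>m\<close>, where \<open>v\<close> is nonzero; division by zero merely excludes
    \<open>c = 0\<close>.\<close>
  have "finite ((\<lambda>k. - lookup v k / lookup u k) ` insert m M)"
    using insert.hyps by simp
  then obtain c where c: "c \<notin> (\<lambda>k. - lookup v k / lookup u k) ` insert m M"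
    using ex_new_if_finite[OF infinite_UNIV_char_0] by blast
  have "lookup (v + pm_scale c u) k \<noteq> 0" if "k \<in> insert m M" for k
  proof (cases "lookup u k = 0")
    case True
    then show ?thesis
      using that u(2) v(2) by (auto simp: lookup_add)
  next
    case False
    have "c \<noteq> - lookup v k / lookup u k"
      using c that by blast
    then show ?thesis
      using False by (auto simp: lookup_add field_simps eq_neg_iff_add_eq_0 add.commute)
  qed
  moreover have "v + pm_scale c u \<in> V"
    using u v V by (simp add: pm.subspace_add pm.subspace_scale)
  ultimately show ?case by blast
qed

text \<open>With \<open>u\<close> of full support, x + c u has full support for all but finitely
  many c, and x is its difference with c u.\<close>

lemma span_full_support:
  assumes V: "pm.subspace V" and M: "finite M" and ex: "\<And>m. m \<in> M \<Longrightarrow> \<exists>v\<in>V. lookup v m \<noteq> 0"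
  shows "V \<subseteq> pm.span {v \<in> V. \<forall>m\<in>M. lookup v m \<noteq> 0}" (is "_ \<subseteq> pm.span ?F")
proof
  fix x assume x: "x \<in> V"
  obtain u where u: "u \<in> V" "\<forall>m\<in>M. lookup u m \<noteq> 0"
    using exists_full_support[OF assms] by blast
  have "finite ((\<lambda>k. - lookup x k / lookup u k) ` M)"
    using M by simp
  then obtain c where c: "c \<notin> (\<lambda>k. - lookup x k / lookup u k) ` M"
    using ex_new_if_finite[OF infinite_UNIV_char_0] by blast
  have "lookup (x + pm_scale c u) k \<noteq> 0" if k: "k \<in> M" for k
  proof -
    have "c \<noteq> - lookup x k / lookup u k" "lookup u k \<noteq> 0"
      using c k u(2) by blast+
    then show ?thesis
      by (auto simp: lookup_add field_simps eq_neg_iff_add_eq_0 add.commute)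
  qed
  then have "x + pm_scale c u \<in> ?F"
    using x u V by (simp add: pm.subspace_add pm.subspace_scale)
  moreover have "u \<in> ?F"
    using u by blast
  ultimately have "(x + pm_scale c u) - pm_scale c u \<in> pm.span ?F"
    by (intro pm.span_diff pm.span_scale pm.span_base)
  then show "x \<in> pm.span ?F" by simp
qed

section \<open>Antipode monomials and supports of quadrics\<close>

definition antipode_monomials :: "nat set \<Rightarrow> nat set \<Rightarrow> monom set" where
  "antipode_monomials I J = (\<lambda>(S, T). pair_mon S T) ` antipodes I J"

text \<open>Determines the cube of which \<open>S\<close> and \<open>T\<close> are antipodes from the monomial \<open>x_S x_T\<close>.\<close>

definition cell :: "monom \<Rightarrow> nat set \<times> nat set" where
  "cell m = (\<Inter>(keys m), \<Union>(keys m))"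

lemma keys_pair_mon: "keys (pair_mon S T) = {S, T}"
  by (auto simp: pair_mon_def in_keys_iff lookup_add lookup_single when_def split: if_splits)

lemma cell_pair_mon: "cell (pair_mon S T) = (S \<inter> T, S \<union> T)"
  by (simp add: cell_def keys_pair_mon)

lemma pair_mon_commute: "pair_mon S T = pair_mon T S"
  by (simp add: pair_mon_def add.commute)

lemma pair_mon_eq_iff: "pair_mon S T = pair_mon S' T' \<longleftrightarrow> S = S' \<and> T = T' \<or> S = T' \<and> T = S'"
  using keys_pair_mon[of S T] keys_pair_mon[of S' T'] pair_mon_commute[of S T]
  by (metis doubleton_eq_iff)

lemma antipodes_iff: "(S, T) \<in> antipodes I J \<longleftrightarrow> S \<inter> T = I \<inter> J \<and> S \<union> T = I \<union> J"
proof -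
  have "S \<union> T = (S \<inter> T) \<union> sym_diff S T" "sym_diff S T = (S \<union> T) - (S \<inter> T)" for S T :: "nat set"
    by blast+
  then show ?thesis
    unfolding antipodes_def by (smt (verit) case_prodI mem_Collect_eq case_prodD)
qed

text \<open>Any antipode monomial of a cube returns its intersection and union through
  \<open>cell\<close>, so different cubes have different sets of antipode monomials.\<close>

lemma antipode_monomials_eq_iff:
  "antipode_monomials I J = antipode_monomials I' J' \<longleftrightarrow> I \<inter> J = I' \<inter> J' \<and> I \<union> J = I' \<union> J'"
proof
  assume "antipode_monomials I J = antipode_monomials I' J'"
  moreover have "pair_mon I J \<in> antipode_monomials I J"
    unfolding antipode_monomials_def by (intro image_eqI[of _ _ "(I, J)"]) (auto simp: antipodes_iff)
  ultimately have "pair_mon I J \<in> antipode_monomials I' J'" by simp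
  then obtain S T where "pair_mon I J = pair_mon S T" "(S, T) \<in> antipodes I' J'"
    by (auto simp: antipode_monomials_def)
  then show "I \<inter> J = I' \<inter> J' \<and> I \<union> J = I' \<union> J'"
    using cell_pair_mon[of I J] cell_pair_mon[of S T] by (simp add: antipodes_iff)
next
  assume "I \<inter> J = I' \<inter> J' \<and> I \<union> J = I' \<union> J'"
  then have "antipodes I J = antipodes I' J'"
    by (auto simp: antipodes_iff)
  then show "antipode_monomials I J = antipode_monomials I' J'"
    by (simp add: antipode_monomials_def)
qed

lemma cell_antipode_monomials: "m \<in> antipode_monomials I J \<Longrightarrow> cell m = (I \<inter> J, I \<union> J)"
  by (auto simp: antipode_monomials_def cell_pair_mon antipodes_iff)

lemma finite_antipodes: "finite (I \<union> J) \<Longrightarrow> finite (antipodes I J)"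
  by (rule finite_subset[of _ "Pow (I \<union> J) \<times> Pow (I \<union> J)"]) (auto simp: antipodes_iff)

lemma lookup_trop: "lookup (trop f) m = (if m \<in> keys f then 1 else 0)"
  by (simp add: trop_def lookup_sum lookup_single when_def)

lemma lookup_antipode_eq:
  assumes "finite (I \<union> J)"
  shows "lookup (antipode_eq I J) m = (if m \<in> antipode_monomials I J then 1 else 0)"
proof -
  \<comment> \<open>Boolean addition is idempotent: a monomial reached from both orderings of a pair
    still has coefficient 1.\<close>
  have sum: "(\<Sum>x\<in>A. if P x then 1 else 0 :: boolean_semifield) = (if \<exists>x\<in>A. P x then 1 else 0)"
    if "finite A" for A :: "'a set" and P
    using that by induction (auto simp: boolean_semifield_one_add_one simp del: one_add_one)
  have "lookup (antipode_eq I J) m = (\<Sum>x\<in>antipodes I J. if (case x of (S, T) \<Rightarrow> pair_mon S T) = m then 1 else 0)"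
    unfolding antipode_eq_def lookup_sum
    by (intro sum.cong refl)
      (auto simp: trop_var_def mult_single pair_mon_def lookup_single when_def)
  then show ?thesis
    unfolding sum[OF finite_antipodes[OF assms]] by (auto simp: antipode_monomials_def)
qed

lemma trop_eq_antipode_eq:
  assumes "finite (I \<union> J)" "keys f = antipode_monomials I J"
  shows "trop f = antipode_eq I J"
  using assms by (intro poly_mapping_eqI) (simp add: lookup_trop lookup_antipode_eq)

lemma flip_antipodes:
  assumes "i \<in> sym_diff S T"
  shows "flip i S \<inter> flip i T = S \<inter> T" "flip i S \<union> flip i T = S \<union> T"
    "sym_diff (flip i S) (flip i T) = sym_diff S T"
  using assms by (auto simp: flip_def)

lemma keys_quadric_subset:
  assumes "S \<subseteq> {1..n}" "T \<subseteq> {1..n}"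
  shows "keys (quadric n S T) \<subseteq> antipode_monomials S T"
proof
  fix m assume "m \<in> keys (quadric n S T)"
  then show "m \<in> antipode_monomials S T"
    using assms
  proof (rule keys_quadricE)
    fix i assume "i \<in> sym_diff S T" "m = pair_mon (flip i S) (flip i T)"
    then show ?thesis
      unfolding antipode_monomials_def
      by (intro image_eqI[of _ _ "(flip i S, flip i T)"]) (simp_all add: antipodes_iff flip_antipodes)
  next
    assume "m = pair_mon S T"
    then show ?thesis
      unfolding antipode_monomials_def
      by (intro image_eqI[of _ _ "(S, T)"]) (simp_all add: antipodes_iff)
  qed
qed

text \<open>In dimension 0 the single coefficient is 1 - 1. In dimension 1 the flip exchanges
  \<open>S\<close> and \<open>T\<close>, and 2 cancels -2. In dimension 2 the two flips give the
  same monomial with opposite signs, and the last coefficient is 0.\<close>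

lemma quadric_eq_0:
  assumes S: "S \<subseteq> {1..n}" and T: "T \<subseteq> {1..n}" and card: "card (sym_diff S T) < 3"
  shows "quadric n S T = 0"
proof -
  let ?D = "sym_diff S T"
  have fin: "finite ?D"
    using S T finite_subset[of _ "{1..n}"] by auto
  have T_eq: "T = sym_diff S ?D" by blast
  consider "?D = {}" | i where "?D = {i}" | i j where "?D = {i, j}" "i < j"
  proof -
    have "card ?D = 0 \<or> card ?D = 1 \<or> card ?D = 2"
      using card by linarith
    then show ?thesis
    proof (elim disjE)
      assume "card ?D = 2"
      then obtain i j where "?D = {i, j}" "i \<noteq> j"
        by (meson card_2_iff)
      then show ?thesis
        using that(3)[of i j] that(3)[of j i] by (cases i j rule: linorder_cases) (auto simp: insert_commute)
    qed (use fin that(1,2) card_1_singletonE[of ?D] in \<open>auto simp: card_eq_0_iff\<close>)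
  qed
  then show ?thesis
  proof cases
    case 1
    then show ?thesis
      unfolding quadric_expand[OF S T] 1 by simp
  next
    case (2 i)
    have "T = sym_diff S {i}"
      using T_eq unfolding 2 .
    then have "flip i S = T"
      by (auto simp: flip_def)
    then have "flip i S = T" "flip i T = S"
      using flip_flip[of i S] by simp_all
    moreover have empty: "{j. j = i \<and> j < i} = {}"
      by auto
    ultimately show ?thesis
      unfolding quadric_expand[OF S T] 2 by (simp add: empty pair_mon_commute[of T S] flip: single_add)
  next
    case (3 i j)
    have "T = sym_diff S {i, j}"
      using T_eq unfolding 3(1) .
    then have "flip i (flip j S) = T" "flip j (flip i S) = T"
      using 3(2) by (auto simp: flip_def)
    then have "flip j S = flip i T" "flip j T = flip i S"
      by (metis flip_flip)+
    moreover have signs: "{k. (k = i \<or> k = j) \<and> k < i} = {}" "{k. (k = i \<or> k = j) \<and> k < j} = {i}"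
      using 3(2) by auto
    ultimately show ?thesis
      using 3(2) unfolding quadric_expand[OF S T] 3(1)
      by (simp add: signs pair_mon_commute[of "flip i T"] flip: single_add)
  qed
qed

text \<open>Flipping \<open>i\<close> back produces the monomial of \<open>S\<close> and
  \<open>T\<close>. In dimension at least 3 no other term of this quadric gives the same unordered
  pair, so nothing cancels it.\<close>

lemma lookup_quadric_neighbour:
  assumes S: "S \<subseteq> {1..n}" and T: "T \<subseteq> {1..n}" and card: "3 \<le> card (sym_diff S T)"
    and i: "i \<in> sym_diff S T"
  shows "lookup (quadric n (flip i S) (flip i T)) (pair_mon S T) \<noteq> 0"
proof -
  let ?D = "sym_diff S T"
  have fin: "finite ?D"
    using S T finite_subset[of _ "{1..n}"] by auto
  have "i \<in> {1..n}"
    using i S T by auto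
  then have sub: "flip i S \<subseteq> {1..n}" "flip i T \<subseteq> {1..n}"
    using S T by (auto simp: flip_def)
  \<comment> \<open>A coincidence of monomials would exchange \<open>S\<close> and \<open>T\<close>
    by flipping at most two indices, forcing the symmetric difference into a set
    \<open>{a, b}\<close>.\<close>
  have two: "\<not> ?D \<subseteq> {a, b}" for a b
    using card card_mono[of "{a, b}" ?D] card_insert_le_m1[of 2 "{b}" a] by (auto simp: card_insert_if split: if_splits)
  have ne1: "pair_mon (flip i S) (flip i T) \<noteq> pair_mon S T"
    using two[of i i] by (auto simp: pair_mon_eq_iff flip_def split: if_splits)
  have ne2: "pair_mon (flip j (flip i S)) (flip j (flip i T)) \<noteq> pair_mon S T" if "j \<noteq> i" for j
  proof -
    have "flip j (flip i S) \<noteq> S"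
      using that by (auto simp: flip_def)
    moreover have "flip j (flip i S) \<noteq> T"
    proof
      assume "flip j (flip i S) = T"
      then have "?D \<subseteq> {i, j}"
        by (auto simp: flip_def split: if_splits)
      then show False
        using two by blast
    qed
    ultimately show ?thesis
      by (simp add: pair_mon_eq_iff)
  qed
  have "lookup (quadric n (flip i S) (flip i T)) (pair_mon S T)
      = (\<Sum>j\<in>?D. if j = i then 2 * (-1) ^ card {k\<in>?D. k < i} else 0)"
    unfolding quadric_expand[OF sub] flip_antipodes(3)[OF i] lookup_add lookup_sum
    using ne1 ne2 by (simp add: lookup_single when_def) (intro sum.cong, auto)
  also have "\<dots> \<noteq> 0"
    using i fin by simp
  finally show ?thesis .
qed

section \<open>Choice of the basis and its tropicalisation\<close>

theorem theoremB:
  fixes n :: nat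
  shows "\<exists>P :: (monom \<Rightarrow>\<^sub>0 complex) set.
    Idl\<^bsub>coord_ring n\<^esub> P = spinor_ideal n
    \<and> pm.independent P \<and> pm.span P = graded_piece 2 (spinor_ideal n)
    \<and> trop ` P = peerless_antipode_eqs n"
proof -
  let ?I2 = "graded_piece 2 (spinor_ideal n)"
  \<comment> \<open>Elements supported on all antipodes of one cube and nowhere else; each
    tropicalises to the equation of that cube.\<close>
  define W where "W = {f \<in> ?I2. \<exists>I J. I \<subseteq> {1..n} \<and> J \<subseteq> {1..n} \<and> 3 \<le> card (sym_diff I J)
    \<and> keys f = antipode_monomials I J}"
  have fin: "finite (I \<union> J)" if "I \<subseteq> {1..n}" "J \<subseteq> {1..n}" for I J
    using that finite_subset[of _ "{1..n}"] by auto
  have quadric_I2: "quadric n S T \<in> ?I2" if "S \<subseteq> {1..n}" "T \<subseteq> {1..n}" for S T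
    unfolding graded_piece_quadrics using that by (intro pm.span_base) blast
  have sub_I2: "pm.subspace ?I2"
    unfolding graded_piece_quadrics by simp
  have quadric_W: "quadric n S T \<in> pm.span W" if ST: "S \<subseteq> {1..n}" "T \<subseteq> {1..n}" for S T
  proof (cases "card (sym_diff S T) < 3")
    case True
    then show ?thesis
      using quadric_eq_0[OF ST] by (simp add: pm.span_zero)
  next
    case False
    then have card: "3 \<le> card (sym_diff S T)" by simp
    define M where "M = antipode_monomials S T"
    \<comment> \<open>The part of the degree two piece living on this cube. It contains the quadrics
      of all antipodes of the cube, so every monomial in \<open>M\<close> occurs in it.\<close>
    define V where "V = {f \<in> ?I2. keys f \<subseteq> M}"
    have V: "pm.subspace V"
    proof (rule pm.subspaceI)
      show "0 \<in> V"
        using pm.subspace_0[OF sub_I2] by (simp add: V_def)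
      show "x + y \<in> V" if "x \<in> V" "y \<in> V" for x y
        using that keys_add[of x y] pm.subspace_add[OF sub_I2] unfolding V_def by blast
      show "pm_scale c x \<in> V" if "x \<in> V" for c x
        using that keys_pm_scale_subset[of c x] pm.subspace_scale[OF sub_I2] unfolding V_def by blast
    qed
    have "finite M"
      using finite_antipodes[OF fin[OF ST]] by (simp add: M_def antipode_monomials_def)
    moreover have "\<exists>v\<in>V. lookup v m \<noteq> 0" if m: "m \<in> M" for m
    proof -
      obtain S' T' where m_eq: "m = pair_mon S' T'" and anti: "(S', T') \<in> antipodes S T"
        using m by (auto simp: M_def antipode_monomials_def)
      have D: "sym_diff S' T' = sym_diff S T" and "S' \<union> T' = S \<union> T"
        using anti antipodes_iff[of S' T'] by (auto simp: antipodes_def)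
      then have ST': "S' \<subseteq> {1..n}" "T' \<subseteq> {1..n}"
        using ST by blast+
      have "sym_diff S' T' \<noteq> {}"
        using card unfolding D by (metis card.empty not_numeral_le_zero)
      then obtain i where i: "i \<in> sym_diff S' T'" by blast
      have sub: "flip i S' \<subseteq> {1..n}" "flip i T' \<subseteq> {1..n}"
        using i ST' by (auto simp: flip_def)
      have "antipode_monomials (flip i S') (flip i T') = M"
        using anti unfolding M_def antipode_monomials_eq_iff
        by (simp add: flip_antipodes[OF i] antipodes_iff)
      then have "quadric n (flip i S') (flip i T') \<in> V"
        using quadric_I2[OF sub] keys_quadric_subset[OF sub] by (simp add: V_def)
      moreover have "lookup (quadric n (flip i S') (flip i T')) m \<noteq> 0"
        unfolding m_eq using ST' card i by (intro lookup_quadric_neighbour) (simp_all add: D)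
      ultimately show ?thesis by blast
    qed
    ultimately have "V \<subseteq> pm.span {v \<in> V. \<forall>m\<in>M. lookup v m \<noteq> 0}"
      by (intro span_full_support V)
    moreover have "{v \<in> V. \<forall>m\<in>M. lookup v m \<noteq> 0} \<subseteq> W"
    proof
      fix v assume "v \<in> {v \<in> V. \<forall>m\<in>M. lookup v m \<noteq> 0}"
      then have "v \<in> ?I2" "keys v = antipode_monomials S T"
        by (auto simp: V_def M_def in_keys_iff)
      then show "v \<in> W"
        unfolding W_def using ST card by blast
    qed
    moreover have "quadric n S T \<in> V"
      using quadric_I2[OF ST] keys_quadric_subset[OF ST] by (simp add: V_def M_def)
    ultimately show ?thesis
      using pm.span_mono by blast
  qed
  have span_W: "pm.span W = ?I2"
  proof
    show "pm.span W \<subseteq> ?I2"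
      by (intro pm.span_minimal sub_I2) (auto simp: W_def)
    have "pm.span {quadric n S T | S T. S \<subseteq> {1..n} \<and> T \<subseteq> {1..n}} \<subseteq> pm.span W"
      using quadric_W by (intro pm.span_minimal pm.subspace_span) auto
    then show "?I2 \<subseteq> pm.span W"
      by (simp add: graded_piece_quadrics)
  qed
  \<comment> \<open>Choosing the basis inside \<open>W\<close> makes every tropicalisation a
    peerless antipode equation.\<close>
  obtain P where P: "P \<subseteq> W" "pm.independent P" "W \<subseteq> pm.span P"
    by (rule pm.maximal_independent_subset)
  have span_P: "pm.span P = ?I2"
    using P(1,3) span_W pm.span_mono[of P W] pm.span_minimal[of W "pm.span P"] by auto
  have "trop ` P = peerless_antipode_eqs n"
  proof
    show "trop ` P \<subseteq> peerless_antipode_eqs n"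
    proof clarify
      fix p assume "p \<in> P"
      then obtain I J where IJ: "I \<subseteq> {1..n}" "J \<subseteq> {1..n}" "3 \<le> card (sym_diff I J)"
        and p: "keys p = antipode_monomials I J"
        using P(1) by (auto simp: W_def)
      show "trop p \<in> peerless_antipode_eqs n"
        unfolding trop_eq_antipode_eq[OF fin[OF IJ(1,2)] p] peerless_antipode_eqs_def using IJ by blast
    qed
    show "peerless_antipode_eqs n \<subseteq> trop ` P"
    proof
      fix g assume "g \<in> peerless_antipode_eqs n"
      then obtain I J where g: "g = antipode_eq I J" and IJ: "I \<subseteq> {1..n}" "J \<subseteq> {1..n}"
        and card: "3 \<le> card (sym_diff I J)"
        by (auto simp: peerless_antipode_eqs_def)
      have "\<exists>p\<in>P. keys p = antipode_monomials I J"
      proof (rule ccontr)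
        assume no: "\<not> ?thesis"
        \<comment> \<open>Projection onto the monomials of this cube. Elements of \<open>P\<close>
          belonging to other cubes are killed, so if none belonged to this one the whole degree two
          piece would be killed, whereas the quadric \<open>?q\<close> of the cube survives.\<close>
        let ?r = "restrict_keys (\<lambda>m. cell m = (I \<inter> J, I \<union> J))"
        have kill: "?r p \<in> {0}" if p: "p \<in> P" for p
        proof -
          obtain I' J' where p': "keys p = antipode_monomials I' J'"
            using P(1) p by (auto simp: W_def)
          then have "\<not> (I \<inter> J = I' \<inter> J' \<and> I \<union> J = I' \<union> J')"
            using no p antipode_monomials_eq_iff[of I' J' I J] by auto
          then have "?r p = 0"
            using cell_antipode_monomials by (intro restrict_keys_zero) (auto simp: p')
          then show ?thesis by simp
        qed
        have "sym_diff I J \<noteq> {}"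
          using card by (metis card.empty not_numeral_le_zero)
        then obtain i where i: "i \<in> sym_diff I J" by blast
        have sub: "flip i I \<subseteq> {1..n}" "flip i J \<subseteq> {1..n}"
          using i IJ by (auto simp: flip_def)
        let ?q = "quadric n (flip i I) (flip i J)"
        have "?q \<in> pm.span P"
          unfolding span_P by (rule quadric_I2[OF sub])
        moreover have "pm.subspace {0 :: poly}"
          by (rule pm.subspaceI) auto
        ultimately have "?r ?q \<in> {0}"
          using kill by (rule restrict_keys_span)
        moreover have "lookup (?r ?q) (pair_mon I J) \<noteq> 0"
          using lookup_quadric_neighbour[OF IJ card i] by (simp add: lookup_restrict_keys cell_pair_mon)
        ultimately show False by simp
      qed
      then show "g \<in> trop ` P"
        unfolding g using trop_eq_antipode_eq[OF fin[OF IJ]] by force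
    qed
  qed
  then show ?thesis
    using genideal_spinor_ideal[OF span_P] span_P P(2) by blast
qed

end
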